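(* Let $X$ be a uniformly convex Banach space. Then for every Banach space $Y$ (over the same field) the pair $(X,Y)$ has the BPBp-ASE. Moreover, every linear subspace $\mathcal M\subseteq \mathcal L(X,Y)$ containing all finite rank operators has the BPBp-ASE.
   Context: Banach spaces are over $\mathbb K\in\{\mathbb R,\mathbb C\}$; $B_X$, $S_X$ are the closed unit ball and unit sphere of $X$; $\mathbb T=\{\lambda\in\mathbb K:|\lambda|=1\}$; $\mathcal L(X,Y)$ is the space of bounded linear operators from $X$ to $Y$. An operator $T\in\mathcal L(X,Y)$ is absolutely strongly exposing, $T\in\mathrm{ASE}(X,Y)$, if there is $x_0\in S_X$ such that whenever $(x_n)\subseteq B_X$ satisfies $\|Tx_n\|\to\|T\|$, there are a subsequence $(x_{\sigma(n)})$ and $\lambda\in\mathbb T$ with $x_{\sigma(n)}\to\lambda x_0$. A linear subspace $\mathcal M\subseteq\mathcal L(X,Y)$ has the BPBp-ASE if for every $\varepsilon>0$ there is $0<\eta(\varepsilon)<\varepsilon$ such that for every $T\in\mathcal M$ with $\|T\|=1$ and every $x\in S_X$ with $\|Tx\|>1-\eta(\varepsilon)$, there exist $S\in\mathrm{ASE}(X,Y)\cap\mathcal M$ and $x_0\in S_X$ with $\|S\|=\|Sx_0\|=1$, $\|S-T\|<\varepsilon$ and $\|x-x_0\|<\varepsilon$. The pair $(X,Y)$ has the BPBp-ASE if $\mathcal M=\mathcal L(X,Y)$ does. $X$ is uniformly convex if for every $\varepsilon>0$ there is $0<\delta<1$ such that $x_1,x_2\in S_X$ and $\|x_1+x_2\|/2>1-\delta$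 imply $\|x_1-x_2\|<\varepsilon$. *)

theory Defs
  imports "HOL-Analysis.Analysis"
begin

text \<open>
  The scalar field \<open>K\<close> is a type that is isometrically isomorphic, as a real normed algebra,
  to the reals or to the complex numbers. Both \<^typ>\<open>real\<close> and \<^typ>\<open>complex\<close> are instances.
\<close>

class real_or_complex = real_normed_field +
  assumes real_or_complex:
    "\<exists>f :: 'a \<Rightarrow> complex.
       (\<forall>a b. f (a + b) = f a + f b) \<and>
       (\<forall>a b. f (a * b) = f a * f b) \<and>
       (\<forall>r a. f (r *\<^sub>R a) = of_real r * f a) \<and>
       (\<forall>a. cmod (f a) = norm a) \<and>
       (range f = \<real> \<or> range f = UNIV)"

instance real :: real_or_complex
  by standard (rule exI[of _ complex_of_real], auto simp: Reals_def)

instance complex :: real_or_complex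
  by standard (rule exI[of _ "\<lambda>z. z"], auto simp: scaleR_conv_of_real)

text \<open>
  A Banach space over \<open>K\<close>: the type class supplies the norm, completeness and the real structure;
  the locale parameter is the multiplication by scalars of \<open>K\<close>.
\<close>

locale banach_over = vector_space scale
  for scale :: "'k::real_or_complex \<Rightarrow> 'v::banach \<Rightarrow> 'v" +
  assumes scale_of_real: "scale (of_real r) v = r *\<^sub>R v"
    and norm_scale: "norm (scale c v) = norm c * norm v"

lemma banach_over_scaleR: "banach_over (scaleR :: real \<Rightarrow> 'v::banach \<Rightarrow> 'v)"
  by unfold_locales (auto simp: algebra_simps)

lemma banach_over_mult: "banach_over ((*) :: complex \<Rightarrow> complex \<Rightarrow> complex)"
  by unfold_locales (auto simp: algebra_simps norm_mult scaleR_conv_of_real)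

definition uniformly_convex :: "'x::real_normed_vector itself \<Rightarrow> bool" where
  "uniformly_convex _ \<longleftrightarrow>
     (\<forall>\<epsilon>>0. \<exists>\<delta>. 0 < \<delta> \<and> \<delta> < 1 \<and>
       (\<forall>x1 x2 :: 'x. norm x1 = 1 \<longrightarrow> norm x2 = 1 \<longrightarrow>
          norm (x1 + x2) / 2 > 1 - \<delta> \<longrightarrow> norm (x1 - x2) < \<epsilon>))"

text \<open>
  The space \<open>\<L>(X, Y)\<close>. The type \<^typ>\<open>'x \<Rightarrow>\<^sub>L 'y\<close> consists of the bounded \<^emph>\<open>real\<close>-linear operators,
  normed by the operator norm; the \<open>K\<close>-linear ones have to be singled out.
\<close>

definition bounded_operators ::
    "('k::real_or_complex \<Rightarrow> 'x::banach \<Rightarrow> 'x) \<Rightarrow> ('k \<Rightarrow> 'y::banach \<Rightarrow> 'y) \<Rightarrow> ('x \<Rightarrow>\<^sub>L 'y) set" where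
  "bounded_operators sX sY = {T. Vector_Spaces.linear sX sY (blinfun_apply T)}"

definition scale_op ::
    "('k::real_or_complex \<Rightarrow> 'y::banach \<Rightarrow> 'y) \<Rightarrow> 'k \<Rightarrow> ('x::banach \<Rightarrow>\<^sub>L 'y) \<Rightarrow> ('x \<Rightarrow>\<^sub>L 'y)" where
  "scale_op sY c T = Blinfun (\<lambda>x. sY c (blinfun_apply T x))"

context banach_over
begin

lemma scale_scaleR: "scale c (r *\<^sub>R v) = r *\<^sub>R scale c v"
  by (simp flip: scale_of_real add: mult.commute)

lemma bounded_linear_scale: "bounded_linear (scale c)"
  by (rule bounded_linear_intro[where K = "norm c"])
     (simp_all add: scale_right_distrib scale_scaleR norm_scale mult.commute)

lemma scale_op_apply: "blinfun_apply (scale_op scale c T) x = scale c (blinfun_apply T x)"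
  unfolding scale_op_def
  by (subst bounded_linear_Blinfun_apply)
     (auto intro!: bounded_linear_compose[OF bounded_linear_scale] blinfun.bounded_linear_right)

lemma norm_scale_op:
  fixes T :: "'b::banach \<Rightarrow>\<^sub>L 'v"
  shows "norm (scale_op scale c T) = norm c * norm T"
proof (rule antisym)
  have le: "norm (scale_op scale c T) \<le> norm c * norm T" for c and T :: "'b \<Rightarrow>\<^sub>L 'v"
    by (rule norm_blinfun_bound)
       (auto simp: scale_op_apply norm_scale mult.assoc intro!: mult_left_mono norm_blinfun)
  show "norm (scale_op scale c T) \<le> norm c * norm T"
    by (rule le)
  show "norm c * norm T \<le> norm (scale_op scale c T)"
  proof (cases "c = 0")
    case False
    have "scale_op scale (inverse c) (scale_op scale c T) = T"
      by (rule blinfun_eqI) (simp add: scale_op_apply False)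
    with le[of "inverse c" "scale_op scale c T"] False show ?thesis
      by (simp add: norm_divide field_simps)
  qed simp
qed

lemma banach_over_scale_op: "banach_over (scale_op scale :: 'k \<Rightarrow> ('x::banach \<Rightarrow>\<^sub>L 'v) \<Rightarrow> _)"
  by unfold_locales
     (auto intro!: blinfun_eqI simp: scale_op_apply plus_blinfun.rep_eq scaleR_blinfun.rep_eq
        scale_left_distrib scale_right_distrib scale_of_real norm_scale_op)

end

definition finite_rank_operators ::
    "('k::real_or_complex \<Rightarrow> 'x::banach \<Rightarrow> 'x) \<Rightarrow> ('k \<Rightarrow> 'y::banach \<Rightarrow> 'y) \<Rightarrow> ('x \<Rightarrow>\<^sub>L 'y) set" where
  "finite_rank_operators sX sY =
     {T \<in> bounded_operators sX sY.
        \<exists>B. finite B \<and> range (blinfun_apply T) \<subseteq> module.span sY B}"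

definition linear_subspace_of_operators ::
    "('k::real_or_complex \<Rightarrow> 'x::banach \<Rightarrow> 'x) \<Rightarrow> ('k \<Rightarrow> 'y::banach \<Rightarrow> 'y) \<Rightarrow>
     ('x \<Rightarrow>\<^sub>L 'y) set \<Rightarrow> bool" where
  "linear_subspace_of_operators sX sY M \<longleftrightarrow>
     M \<subseteq> bounded_operators sX sY \<and> module.subspace (scale_op sY) M"

definition ASE ::
    "('k::real_or_complex \<Rightarrow> 'x::banach \<Rightarrow> 'x) \<Rightarrow> ('k \<Rightarrow> 'y::banach \<Rightarrow> 'y) \<Rightarrow> ('x \<Rightarrow>\<^sub>L 'y) set" where
  "ASE sX sY =
     {T \<in> bounded_operators sX sY.
        \<exists>x0. norm x0 = 1 \<and>
          (\<forall>x :: nat \<Rightarrow> 'x. (\<forall>n. norm (x n) \<le> 1) \<longrightarrow>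
             (\<lambda>n. norm (blinfun_apply T (x n))) \<longlonglongrightarrow> norm T \<longrightarrow>
             (\<exists>\<sigma> c. strict_mono \<sigma> \<and> norm c = 1 \<and> (\<lambda>n. x (\<sigma> n)) \<longlonglongrightarrow> sX c x0))}"

definition has_BPBp_ASE ::
    "('k::real_or_complex \<Rightarrow> 'x::banach \<Rightarrow> 'x) \<Rightarrow> ('k \<Rightarrow> 'y::banach \<Rightarrow> 'y) \<Rightarrow>
     ('x \<Rightarrow>\<^sub>L 'y) set \<Rightarrow> bool" where
  "has_BPBp_ASE sX sY M \<longleftrightarrow>
     (\<forall>\<epsilon>>0. \<exists>\<eta>. 0 < \<eta> \<and> \<eta> < \<epsilon> \<and>
       (\<forall>T\<in>M. \<forall>x. norm T = 1 \<longrightarrow> norm x = 1 \<longrightarrow> norm (blinfun_apply T x) > 1 - \<eta> \<longrightarrow>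
          (\<exists>S \<in> ASE sX sY \<inter> M. \<exists>x0. norm x0 = 1 \<and> norm S = 1 \<and> norm (blinfun_apply S x0) = 1 \<and>
             norm (S - T) < \<epsilon> \<and> norm (x - x0) < \<epsilon>)))"

definition pair_has_BPBp_ASE ::
    "('k::real_or_complex \<Rightarrow> 'x::banach \<Rightarrow> 'x) \<Rightarrow> ('k \<Rightarrow> 'y::banach \<Rightarrow> 'y) \<Rightarrow> bool" where
  "pair_has_BPBp_ASE sX sY \<longleftrightarrow> has_BPBp_ASE sX sY (bounded_operators sX sY)"

end

theory Submission
  imports Defs
begin

text \<open>
  Why the theorem holds. Let \<open>T\<close> have norm one and almost attain its norm at the unit vector \<open>x\<close>.
  For a bounded \<open>K\<close>-linear functional \<open>h\<close> consider the seminorm \<open>p z = \<parallel>T z\<parallel> + \<bar>h z\<bar>\<close> on the unit ball of \<open>X\<close>.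
  If \<open>p\<close> attains its maximum at \<open>x0\<close>, and \<open>y\<close> is the direction of \<open>T x0\<close>, then a unimodular multiple of the
  rank-one operator \<open>z \<mapsto> h z \<cdot> y\<close>, added to \<open>T\<close>, gives an operator \<open>T + R\<close> with
  \<open>\<parallel>(T + R) z\<parallel> \<le> p z\<close> and equality at \<open>x0\<close>. So the operator attains its norm where \<open>p\<close> does, and it
  inherits strong exposition: if every maximizing sequence of \<open>p\<close> subconverges to the orbit of \<open>x0\<close> under
  unimodular scalars, then so does every maximizing sequence of \<open>T + R\<close>. Only one operator of
  finite rank has been added, which is why the perturbation stays in every subspace containing those
  operators, closed or not.

  It remains to find such an \<open>h\<close> that is small and whose maximizer is close to \<open>x\<close>. Existence is a
  variational principle in the style of Stegall (\<open>exposing_dense\<close>): the \<open>h\<close> for which \<open>p\<close> has a strong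
  maximum, up to unimodular scalars, are dense in the dual space. They form the intersection over
  \<open>\<epsilon>\<close> of the sets of \<open>h\<close> whose near-maximizers are pairwise closer than \<open>\<epsilon>\<close> modulo unimodular
  scalars. These sets are open, and by Baire's theorem it suffices that each is dense. For that,
  take a near-maximizer \<open>u\<close> of \<open>p\<close> and add to \<open>h\<close> a small multiple \<open>d g\<close> of a functional \<open>g\<close> norming \<open>u\<close>,
  with the phase that makes the moduli add up at \<open>u\<close>. A near-maximizer \<open>z\<close> of the new
  seminorm must then almost norm \<open>g\<close>, and uniform convexity puts \<open>z\<close> close to the orbit of \<open>u\<close>
  (\<open>functional_slice_small\<close>).

  The localization near \<open>x\<close> is the same mechanism: start from \<open>h = d g\<close> with \<open>g\<close> norming \<open>x\<close>, and
  approximate it by an \<open>h\<close> from the dense set. Since \<open>\<parallel>T x\<parallel>\<close> is almost one, any maximizer of \<open>p\<close> almost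
  norms \<open>g\<close>, hence is close to the orbit of \<open>x\<close>.

  The norming functionals come from the Hahn-Banach theorem, proved here for sublinear functionals by
  Zorn's lemma. Functionals take values in the complex numbers, into which the scalar
  field is embedded; thus the dual space is a closed subset of a Banach space for both
  kinds of scalars.
\<close>

section \<open>Norming functionals\<close>

definition sublinear :: "('x::real_vector \<Rightarrow> real) \<Rightarrow> bool" where
  "sublinear q \<longleftrightarrow> (\<forall>x y. q (x + y) \<le> q x + q y) \<and> (\<forall>r x. 0 \<le> r \<longrightarrow> q (r *\<^sub>R x) = r * q x)"

lemma sublinearI:
  assumes "\<And>x y. q (x + y) \<le> q x + q y" and "\<And>r x. 0 \<le> r \<Longrightarrow> q (r *\<^sub>R x) = r * q x"
  shows "sublinear q"
  using assms by (auto simp: sublinear_def)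

lemma sublinearI_le:
  assumes add: "\<And>x y. q (x + y) \<le> q x + q y"
    and scale: "\<And>r x. 0 < r \<Longrightarrow> q (r *\<^sub>R x) \<le> r * q x"
    and zero: "q 0 = 0"
  shows "sublinear q"
proof (rule sublinearI)
  fix r x
  assume "(0::real) \<le> r"
  show "q (r *\<^sub>R x) = r * q x"
  proof (cases "r = 0")
    case False
    with \<open>0 \<le> r\<close> have r: "0 < r" by simp
    then have "q ((1 / r) *\<^sub>R (r *\<^sub>R x)) \<le> (1 / r) * q (r *\<^sub>R x)"
      by (intro scale) simp
    then have "r * q x \<le> q (r *\<^sub>R x)"
      using r by (simp add: field_simps)
    with scale[OF r, of x] show ?thesis by simp
  qed (simp add: zero)
qed (rule add)

lemma sublinear_add: "sublinear q \<Longrightarrow> q (x + y) \<le> q x + q y"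
  and sublinear_scaleR: "sublinear q \<Longrightarrow> 0 \<le> r \<Longrightarrow> q (r *\<^sub>R x) = r * q x"
  by (auto simp: sublinear_def)

lemma sublinear_zero: "sublinear q \<Longrightarrow> q 0 = 0"
  using sublinear_scaleR[of q 0 0] by simp

lemma sublinear_minus: "sublinear q \<Longrightarrow> - q (- x) \<le> q x"
  using sublinear_add[of q x "- x"] sublinear_zero[of q] by simp

lemma sublinear_norm: "sublinear norm"
  by (auto simp: sublinear_def norm_triangle_ineq)

text \<open>
  For sublinear \<open>q\<close>, the largest sublinear functional below \<open>q\<close> whose value at \<open>- a\<close> is at most \<open>- q a\<close>. Every
  linear functional below it therefore agrees with \<open>q\<close> at \<open>a\<close>.
\<close>

definition shift_sublinear :: "('x::real_vector \<Rightarrow> real) \<Rightarrow> 'x \<Rightarrow> 'x \<Rightarrow> real" where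
  "shift_sublinear q a z = (INF t\<in>{0..}. q (z + t *\<^sub>R a) - t * q a)"

lemma shift_sublinear_bdd_below:
  assumes "sublinear q"
  shows "bdd_below ((\<lambda>t. q (z + t *\<^sub>R a) - t * q a) ` {0..})"
proof (rule bdd_belowI2)
  fix t :: real
  assume "t \<in> {0..}"
  then have "t * q a \<le> q (z + t *\<^sub>R a) + q (- z)"
    using sublinear_add[OF assms, of "z + t *\<^sub>R a" "- z"] sublinear_scaleR[OF assms, of t a] by simp
  then show "- q (- z) \<le> q (z + t *\<^sub>R a) - t * q a" by simp
qed

lemma shift_sublinear_le:
  assumes "sublinear q" "0 \<le> t"
  shows "shift_sublinear q a z \<le> q (z + t *\<^sub>R a) - t * q a"
  unfolding shift_sublinear_def using assms
  by (intro cINF_lower shift_sublinear_bdd_below) auto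

lemma le_shift_sublinear:
  assumes "\<And>t. 0 \<le> t \<Longrightarrow> c \<le> q (z + t *\<^sub>R a) - t * q a"
  shows "c \<le> shift_sublinear q a z"
  unfolding shift_sublinear_def by (rule cINF_greatest) (use assms in auto)

lemma sublinear_shift:
  assumes q: "sublinear q"
  shows "sublinear (shift_sublinear q a)"
proof (rule sublinearI_le)
  let ?s = "shift_sublinear q a"
  fix x y
  have "?s (x + y) - (q (y + u *\<^sub>R a) - u * q a) \<le> q (x + t *\<^sub>R a) - t * q a"
    if "0 \<le> t" "0 \<le> u" for t u
  proof -
    have "?s (x + y) \<le> q ((x + y) + (t + u) *\<^sub>R a) - (t + u) * q a"
      using that by (intro shift_sublinear_le[OF q]) simp
    also have "(x + y) + (t + u) *\<^sub>R a = (x + t *\<^sub>R a) + (y + u *\<^sub>R a)"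
      by (simp add: algebra_simps)
    also have "q \<dots> \<le> q (x + t *\<^sub>R a) + q (y + u *\<^sub>R a)"
      by (rule sublinear_add[OF q])
    finally show ?thesis by (simp add: algebra_simps)
  qed
  then have "?s (x + y) - (q (y + u *\<^sub>R a) - u * q a) \<le> ?s x" if "0 \<le> u" for u
    using that by (intro le_shift_sublinear) auto
  then have "?s (x + y) - ?s x \<le> q (y + u *\<^sub>R a) - u * q a" if "0 \<le> u" for u
    using that by (simp add: algebra_simps)
  then have "?s (x + y) - ?s x \<le> ?s y"
    by (rule le_shift_sublinear)
  then show "?s (x + y) \<le> ?s x + ?s y" by simp
next
  let ?s = "shift_sublinear q a"
  fix r :: real and x
  assume r: "0 < r"
  have "?s (r *\<^sub>R x) / r \<le> ?s x"
  proof (rule le_shift_sublinear)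
    fix t :: real
    assume t: "0 \<le> t"
    have "?s (r *\<^sub>R x) \<le> q (r *\<^sub>R x + (r * t) *\<^sub>R a) - (r * t) * q a"
      using r t by (intro shift_sublinear_le[OF q]) simp
    also have "q (r *\<^sub>R x + (r * t) *\<^sub>R a) = r * q (x + t *\<^sub>R a)"
      using sublinear_scaleR[OF q, of r "x + t *\<^sub>R a"] r by (simp add: scaleR_add_right)
    also have "\<dots> - (r * t) * q a = r * (q (x + t *\<^sub>R a) - t * q a)"
      by (simp add: algebra_simps)
    finally show "?s (r *\<^sub>R x) / r \<le> q (x + t *\<^sub>R a) - t * q a"
      using r by (simp add: field_simps)
  qed
  then show "?s (r *\<^sub>R x) \<le> r * ?s x"
    using r by (simp add: field_simps)
next
  have "0 \<le> shift_sublinear q a 0"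
    by (rule le_shift_sublinear) (simp add: sublinear_scaleR[OF q])
  moreover have "shift_sublinear q a 0 \<le> 0"
    using shift_sublinear_le[OF q order_refl, of a 0] by (simp add: sublinear_zero[OF q])
  ultimately show "shift_sublinear q a 0 = 0" by simp
qed

lemma shift_sublinear_le_self: "sublinear q \<Longrightarrow> shift_sublinear q a z \<le> q z"
  using shift_sublinear_le[of q 0 a z] by simp

text \<open>
  Shifting \<open>q\<close> along \<open>a\<close> cannot lower a minimal \<open>q\<close>, and that says \<open>q z \<le> q (z + a) - q a\<close>: superadditivity.
\<close>

lemma minimal_sublinear_linear:
  assumes q: "sublinear q"
    and minimal: "\<And>q'. sublinear q' \<Longrightarrow> (\<And>z. q' z \<le> q z) \<Longrightarrow> q' = q"
  shows "linear q"
proof -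
  have ge: "q z + q a \<le> q (z + a)" for z a
  proof -
    have "shift_sublinear q a = q"
      by (intro minimal sublinear_shift shift_sublinear_le_self q)
    then show ?thesis
      using shift_sublinear_le[OF q, of 1 a z] by simp
  qed
  have add: "q (z + a) = q z + q a" for z a
    using ge[of z a] sublinear_add[OF q, of z a] by simp
  have minus: "q (- z) = - q z" for z
    using add[of z "- z"] sublinear_zero[OF q] by simp
  have "q (r *\<^sub>R z) = r * q z" for r z
  proof (cases "0 \<le> r")
    case False
    then have "q ((- r) *\<^sub>R z) = (- r) * q z"
      by (intro sublinear_scaleR[OF q]) simp
    then show ?thesis
      using minus[of "r *\<^sub>R z"] by simp
  qed (rule sublinear_scaleR[OF q])
  with add show ?thesis
    by (intro linearI) simp_all
qed

text \<open>
  In a chain, any two members \<open>q\<close>, \<open>q'\<close> lie above a common member, so the infimum at \<open>x + y\<close> is bounded by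
  \<open>q x + q' y\<close> with \<open>q\<close> and \<open>q'\<close> chosen independently; this gives subadditivity.
\<close>

lemma sublinear_INF_chain:
  fixes C :: "('x::real_vector \<Rightarrow> real) set"
  assumes "C \<noteq> {}"
    and sub: "\<And>q. q \<in> C \<Longrightarrow> sublinear q"
    and chain: "\<And>q q'. q \<in> C \<Longrightarrow> q' \<in> C \<Longrightarrow> q \<le> q' \<or> q' \<le> q"
    and bdd: "\<And>z. bdd_below ((\<lambda>q. q z) ` C)"
  shows "sublinear (\<lambda>z. INF q\<in>C. q z)"
proof (rule sublinearI_le)
  let ?s = "\<lambda>z. INF q\<in>C. q z"
  have le: "?s z \<le> q z" if "q \<in> C" for q z
    using that bdd by (rule cINF_lower[rotated])
  have ge: "c \<le> ?s z" if "\<And>q. q \<in> C \<Longrightarrow> c \<le> q z" for c z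
    using assms(1) that by (rule cINF_greatest)
  fix x y
  have "?s (x + y) - q' y \<le> q x" if q: "q \<in> C" "q' \<in> C" for q q'
  proof -
    have "\<exists>p\<in>C. p \<le> q \<and> p \<le> q'"
      using chain[OF q] q by auto
    then obtain p where p: "p \<in> C" "p \<le> q" "p \<le> q'" by blast
    have "?s (x + y) \<le> p (x + y)" by (rule le[OF p(1)])
    also have "\<dots> \<le> p x + p y" by (rule sublinear_add[OF sub[OF p(1)]])
    also have "\<dots> \<le> q x + q' y" using p(2,3) by (intro add_mono) (auto simp: le_fun_def)
    finally show ?thesis by simp
  qed
  then have "?s (x + y) - q' y \<le> ?s x" if "q' \<in> C" for q'
    using that by (intro ge) auto
  then have "?s (x + y) - ?s x \<le> q' y" if "q' \<in> C" for q'
    using that by (simp add: algebra_simps)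
  then have "?s (x + y) - ?s x \<le> ?s y"
    by (rule ge)
  then show "?s (x + y) \<le> ?s x + ?s y" by simp
next
  fix r :: real and x
  assume r: "0 < r"
  have "(INF q\<in>C. q (r *\<^sub>R x)) / r \<le> (INF q\<in>C. q x)"
  proof (rule cINF_greatest[OF assms(1)])
    fix q
    assume q: "q \<in> C"
    have "(INF q\<in>C. q (r *\<^sub>R x)) \<le> q (r *\<^sub>R x)"
      using q bdd by (rule cINF_lower[rotated])
    with r show "(INF q\<in>C. q (r *\<^sub>R x)) / r \<le> q x"
      by (simp add: sublinear_scaleR[OF sub[OF q]] field_simps)
  qed
  then show "(INF q\<in>C. q (r *\<^sub>R x)) \<le> r * (INF q\<in>C. q x)"
    using r by (simp add: field_simps)
next
  have "(\<lambda>q. q 0) ` C = {0}"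
    using assms(1) sublinear_zero[OF sub] by force
  then show "(INF q\<in>C. q 0) = 0" by simp
qed

text \<open>
  The Hahn-Banach theorem: Zorn's lemma yields a minimal sublinear functional below \<open>q\<close>. Chains are
  bounded below pointwise because \<open>- q (- z) \<le> - p (- z) \<le> p z\<close> for \<open>p \<le> q\<close>.
\<close>

lemma linear_below_sublinear:
  fixes q :: "'x::real_vector \<Rightarrow> real"
  assumes q: "sublinear q"
  obtains u where "linear u" "\<And>z. u z \<le> q z"
proof -
  define A where "A = {q'. sublinear q' \<and> q' \<le> q}"
  have "\<exists>m\<in>A. \<forall>a\<in>A. m \<ge> a \<longrightarrow> a = m"
  proof (rule predicate_Zorn)
    show "partial_order_on A (relation_of (\<lambda>p p'. p \<ge> p') A)"
      by (rule partial_order_on_relation_ofI) auto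
  next
    fix C
    assume C: "C \<in> Chains (relation_of (\<lambda>p p'. p \<ge> p') A)"
    then have chain: "p \<le> p' \<or> p' \<le> p" if "p \<in> C" "p' \<in> C" for p p'
      using that by (auto simp: Chains_def relation_of_def)
    show "\<exists>m\<in>A. \<forall>a\<in>C. a \<ge> m"
    proof (cases "C = {}")
      case True
      with q show ?thesis by (intro bexI[of _ q]) (auto simp: A_def)
    next
      case False
      have CA: "C \<subseteq> A"
        using C by (auto simp: Chains_def relation_of_def)
      have bdd: "bdd_below ((\<lambda>p. p z) ` C)" for z
      proof (rule bdd_belowI2)
        fix p
        assume "p \<in> C"
        then have "sublinear p" "p (- z) \<le> q (- z)"
          using CA by (auto simp: A_def le_fun_def)
        then show "- q (- z) \<le> p z"
          using sublinear_minus[of p z] by simp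
      qed
      let ?m = "\<lambda>z. INF p\<in>C. p z"
      have le: "?m \<le> p" if "p \<in> C" for p
        using that by (auto simp: le_fun_def intro: cINF_lower[OF bdd])
      have "sublinear ?m"
        using False CA chain bdd by (intro sublinear_INF_chain) (auto simp: A_def)
      moreover have "?m \<le> q"
        using False CA le by (force simp: A_def intro: order_trans)
      ultimately have "?m \<in> A" by (simp add: A_def)
      with le show ?thesis by blast
    qed
  qed
  then obtain m where m: "sublinear m" "m \<le> q" "\<And>a. a \<in> A \<Longrightarrow> a \<le> m \<Longrightarrow> a = m"
    by (auto simp: A_def)
  have "linear m"
  proof (rule minimal_sublinear_linear[OF m(1)])
    fix q'
    assume q': "sublinear q'" "\<And>z. q' z \<le> m z"
    then have "q' \<le> m" by (simp add: le_fun_def)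
    with q'(1) m(2) have "q' \<in> A" by (auto simp: A_def)
    with \<open>q' \<le> m\<close> show "q' = m" by (intro m(3))
  qed
  with m(2) show thesis
    by (intro that) (auto simp: le_fun_def)
qed

text \<open>
  Applied to the norm shifted along \<open>x\<close>, whose value at \<open>- x\<close> is at most \<open>- \<parallel>x\<parallel>\<close>, the Hahn-Banach
  theorem produces a functional norming \<open>x\<close>.
\<close>

lemma real_norming_functional:
  fixes x :: "'x::real_normed_vector"
  obtains u where "linear u" "\<And>z. u z \<le> norm z" "u x = norm x"
proof -
  obtain u where u: "linear u" "\<And>z. u z \<le> shift_sublinear norm x z"
    using linear_below_sublinear[OF sublinear_shift[OF sublinear_norm]] by blast
  have le: "u z \<le> norm z" for z
    using u(2)[of z] shift_sublinear_le_self[OF sublinear_norm, of x z] by linarith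
  have "u (- x) \<le> - norm x"
    using u(2)[of "- x"] shift_sublinear_le[OF sublinear_norm, of 1 x "- x"] by simp
  with le[of x] have "u x = norm x"
    by (simp add: linear_neg[OF u(1)])
  with u(1) le show thesis by (rule that)
qed

section \<open>Scalars and functionals\<close>

locale scalar_embedding =
  fixes \<phi> :: "'k::real_or_complex \<Rightarrow> complex"
  assumes embed_add: "\<phi> (a + b) = \<phi> a + \<phi> b"
    and embed_mult: "\<phi> (a * b) = \<phi> a * \<phi> b"
    and embed_scaleR: "\<phi> (r *\<^sub>R a) = of_real r * \<phi> a"
    and cmod_embed: "cmod (\<phi> a) = norm a"
    and range_embed: "range \<phi> = \<real> \<or> range \<phi> = UNIV"
begin

lemma embed_zero: "\<phi> 0 = 0"
  using cmod_embed[of 0] by simp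

lemma embed_one: "\<phi> 1 = 1"
  using embed_mult[of 1 1] cmod_embed[of 1] by force

lemma embed_of_real: "\<phi> (of_real r) = of_real r"
  using embed_scaleR[of r 1] by (simp add: embed_one of_real_def)

lemma embed_minus: "\<phi> (- a) = - \<phi> a"
  using embed_scaleR[of "- 1" a] by simp

lemma embed_diff: "\<phi> (a - b) = \<phi> a - \<phi> b"
  using embed_add[of a "- b"] by (simp add: embed_minus)

lemma embed_eq_iff: "\<phi> a = \<phi> b \<longleftrightarrow> a = b"
  using cmod_embed[of "a - b"] by (auto simp: embed_diff)

lemma closed_range_embed: "closed (range \<phi>)"
  using range_embed closed_complex_Reals by auto

text \<open>
  The assumption on \<open>w\<close> matters for real scalars: they offer no phase that rotates a
  non-real number to the positive axis.
\<close>

lemma embed_phase: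
  assumes "w \<in> range \<phi>"
  obtains c where "norm c = 1" "\<phi> c * w = of_real (cmod w)"
proof (cases "w = 0")
  case True
  then show thesis by (intro that[of 1]) auto
next
  case False
  from assms obtain a where a: "w = \<phi> a" by blast
  with False have "a \<noteq> 0" by (auto simp: embed_zero)
  then have "norm (of_real (norm a) / a) = 1"
    by (simp add: norm_divide)
  moreover have "\<phi> (of_real (norm a) / a) * w = of_real (cmod w)"
    using \<open>a \<noteq> 0\<close> unfolding a by (simp flip: embed_mult add: embed_of_real cmod_embed)
  ultimately show thesis by (rule that)
qed

lemma unimodular_convergent_subseq:
  fixes c :: "nat \<Rightarrow> 'k"
  assumes "\<And>n. norm (c n) = 1"
  obtains \<sigma> l where "strict_mono \<sigma>" "norm l = 1" "(\<lambda>n. c (\<sigma> n)) \<longlonglongrightarrow> l"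
proof -
  have "seq_compact (sphere 0 1 \<inter> range \<phi>)"
    by (intro compact_imp_seq_compact compact_Int_closed closed_range_embed) simp
  moreover have "\<forall>n. \<phi> (c n) \<in> sphere 0 1 \<inter> range \<phi>"
    using assms by (simp add: cmod_embed)
  ultimately obtain w \<sigma> where w: "w \<in> sphere 0 1 \<inter> range \<phi>" "strict_mono \<sigma>"
    "((\<lambda>n. \<phi> (c n)) \<circ> \<sigma>) \<longlonglongrightarrow> w"
    by (rule seq_compactE)
  from w(1) obtain l where l: "w = \<phi> l" by blast
  have "(\<lambda>n. norm (c (\<sigma> n) - l)) \<longlonglongrightarrow> 0"
    using tendsto_norm_zero[OF LIM_zero[OF w(3)]]
    by (simp add: l cmod_embed flip: embed_diff)
  then have "(\<lambda>n. c (\<sigma> n)) \<longlonglongrightarrow> l"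
    by (rule LIM_zero_cancel[OF tendsto_norm_zero_cancel])
  moreover have "norm l = 1"
    using w(1) by (simp add: l cmod_embed)
  ultimately show thesis using w(2) that by blast
qed

end

lemma scalar_embedding_exists:
  "\<exists>\<phi> :: 'k::real_or_complex \<Rightarrow> complex. scalar_embedding \<phi>"
  using real_or_complex unfolding scalar_embedding_def by metis

locale operator_setting =
  X: banach_over sX + Y: banach_over sY + scalar_embedding \<phi>
  for sX :: "'k::real_or_complex \<Rightarrow> 'x::banach \<Rightarrow> 'x"
    and sY :: "'k \<Rightarrow> 'y::banach \<Rightarrow> 'y"
    and \<phi> :: "'k \<Rightarrow> complex"
begin

text \<open>
  The dual space of \<open>X\<close>, transported along the embedding of the scalars into the complex numbers. For
  real scalars, the range condition keeps the values real.
\<close>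

definition functionals :: "('x \<Rightarrow>\<^sub>L complex) set" where
  "functionals = {h. (\<forall>a z. blinfun_apply h (sX a z) = \<phi> a * h z) \<and> (\<forall>z. blinfun_apply h z \<in> range \<phi>)}"

lemma functional_scale: "h \<in> functionals \<Longrightarrow> blinfun_apply h (sX a z) = \<phi> a * h z"
  and functional_range: "h \<in> functionals \<Longrightarrow> blinfun_apply h z \<in> range \<phi>"
  by (auto simp: functionals_def)

lemma functionals_add: "g \<in> functionals \<Longrightarrow> h \<in> functionals \<Longrightarrow> g + h \<in> functionals"
proof -
  assume gh: "g \<in> functionals" "h \<in> functionals"
  have "blinfun_apply g z + blinfun_apply h z \<in> range \<phi>" for z
    using functional_range[OF gh(1), of z] functional_range[OF gh(2), of z]
    by (metis (no_types) embed_add rangeE rangeI)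
  with gh show ?thesis
    by (auto simp: functionals_def blinfun.add_left algebra_simps)
qed

lemma functionals_scaleR: "h \<in> functionals \<Longrightarrow> r *\<^sub>R h \<in> functionals"
proof -
  assume h: "h \<in> functionals"
  have "r *\<^sub>R blinfun_apply h z \<in> range \<phi>" for z
    using functional_range[OF h, of z]
    by (metis (no_types) embed_scaleR rangeE rangeI scaleR_conv_of_real)
  with h show ?thesis
    by (auto simp: functionals_def blinfun.scaleR_left algebra_simps)
qed

lemma functionals_rotate:
  assumes g: "g \<in> functionals"
  obtains g' where "g' \<in> functionals" "\<And>z. blinfun_apply g' z = \<phi> a * g z"
proof -
  let ?g' = "Blinfun (\<lambda>z. \<phi> a * blinfun_apply g z)"
  have app: "blinfun_apply ?g' z = \<phi> a * g z" for z
    by (subst bounded_linear_Blinfun_apply)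
      (auto intro!: bounded_linear_intros blinfun.bounded_linear_right)
  have "\<phi> a * blinfun_apply g z \<in> range \<phi>" for z
    using functional_range[OF g, of z] by (metis embed_mult rangeE rangeI)
  with g have "?g' \<in> functionals"
    by (auto simp: functionals_def app)
  with app show thesis by (intro that)
qed

lemma closed_functionals: "closed functionals"
proof -
  have "functionals =
      (\<Inter>a z. {h. blinfun_apply h (sX a z) = \<phi> a * h z}) \<inter> (\<Inter>z. (\<lambda>h. blinfun_apply h z) -` range \<phi>)"
    by (auto simp: functionals_def)
  also have "closed \<dots>"
    by (intro closed_Int closed_INT ballI closed_Collect_eq closed_vimage closed_range_embed
        continuous_intros)
  finally show ?thesis .
qed

text \<open>
  For complex scalars this is the classical \<open>g z = u z - i u (i z)\<close>; for real scalars \<open>g = u\<close>.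
\<close>

lemma complexify:
  fixes u :: "'x \<Rightarrow> real"
  assumes "linear u"
  obtains g where "linear g" "\<And>a z. g (sX a z) = \<phi> a * g z" "\<And>z. g z \<in> range \<phi>" "\<And>z. Re (g z) = u z"
proof (cases "range \<phi> = UNIV")
  case True
  then obtain j where j: "\<phi> j = \<i>" by (metis rangeE UNIV_I)
  let ?g = "\<lambda>z. Complex (u z) (- u (sX j z))"
  note lin = linear_add[OF assms] linear_scale[OF assms] linear_neg[OF assms]
  have jj: "j * j = - 1"
    by (simp flip: embed_eq_iff add: embed_mult embed_minus embed_one j)
  have split: "sX a z = Re (\<phi> a) *\<^sub>R z + Im (\<phi> a) *\<^sub>R sX j z" for a z
  proof -
    have "a = of_real (Re (\<phi> a)) + of_real (Im (\<phi> a)) * j"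
      by (simp flip: embed_eq_iff add: embed_add embed_mult embed_of_real j)
        (metis complex_eq mult.commute)
    then have "sX a z = sX (of_real (Re (\<phi> a)) + of_real (Im (\<phi> a)) * j) z"
      by simp
    then show ?thesis
      by (simp add: X.scale_left_distrib X.scale_of_real flip: X.scale_scale)
  qed
  have "linear ?g"
    by (intro linearI)
      (simp_all add: complex_eq_iff lin X.scale_right_distrib X.scale_scaleR)
  moreover have "?g (sX a z) = \<phi> a * ?g z" for a z
  proof -
    have "sX j (sX a z) = Re (\<phi> a) *\<^sub>R sX j z - Im (\<phi> a) *\<^sub>R z"
      by (simp add: split[of a] X.scale_right_distrib X.scale_scaleR jj)
    then have "u (sX j (sX a z)) = Re (\<phi> a) * u (sX j z) - Im (\<phi> a) * u z"
      by (simp add: linear_diff[OF assms] lin)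
    moreover have "u (sX a z) = Re (\<phi> a) * u z + Im (\<phi> a) * u (sX j z)"
      by (simp add: split[of a] lin)
    ultimately show ?thesis
      by (simp add: complex_eq_iff algebra_simps)
  qed
  ultimately show thesis using True by (intro that[of ?g]) auto
next
  case False
  with range_embed have R: "range \<phi> = \<real>" by blast
  let ?g = "\<lambda>z. complex_of_real (u z)"
  have "linear ?g"
    by (intro linearI) (simp_all add: linear_add[OF assms] linear_scale[OF assms] scaleR_conv_of_real)
  moreover have "?g (sX a z) = \<phi> a * ?g z" for a z
  proof -
    have "\<phi> a \<in> \<real>" using R by blast
    then obtain r where r: "\<phi> a = of_real r" by (auto elim: Reals_cases)
    then have "a = of_real r"
      by (simp flip: embed_eq_iff add: embed_of_real)
    then show ?thesis
      by (simp add: embed_of_real X.scale_of_real linear_scale[OF assms])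
  qed
  ultimately show thesis using R by (intro that[of ?g]) auto
qed

text \<open>
  The norm of the complexified functional is that of its real part: rotating \<open>z\<close> makes the
  value at \<open>z\<close> real.
\<close>

lemma norming_functional:
  obtains g where "g \<in> functionals" "\<And>z. cmod (blinfun_apply g z) \<le> norm z" "cmod (blinfun_apply g x) = norm x"
proof -
  obtain u where u: "linear u" "\<And>z. u z \<le> norm z" "u x = norm x"
    using real_norming_functional[of x] by blast
  obtain g where g: "linear g" "\<And>a z. g (sX a z) = \<phi> a * g z" "\<And>z. g z \<in> range \<phi>"
    "\<And>z. Re (g z) = u z"
    using complexify[OF u(1)] by blast
  have le: "cmod (g z) \<le> norm z" for z
  proof -
    obtain c where c: "norm c = 1" "\<phi> c * g z = of_real (cmod (g z))"
      using embed_phase[OF g(3)] by blast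
    have "cmod (g z) = Re (g (sX c z))"
      by (simp add: g(2) c(2))
    also have "\<dots> \<le> norm (sX c z)"
      by (simp add: g(4) u(2))
    finally show ?thesis by (simp add: X.norm_scale c(1))
  qed
  have "bounded_linear g"
    using le by (intro bounded_linear_intro[where K = 1]) (auto simp: linear_add[OF g(1)] linear_scale[OF g(1)])
  then have app: "blinfun_apply (Blinfun g) = g"
    by (rule bounded_linear_Blinfun_apply)
  have "norm x \<le> cmod (g x)"
    using complex_Re_le_cmod[of "g x"] by (simp add: g(4) u(3))
  with le[of x] have "cmod (g x) = norm x" by simp
  with le g(2,3) show thesis
    by (intro that[of "Blinfun g"]) (auto simp: app functionals_def)
qed

end

section \<open>Uniform convexity\<close>

text \<open>
  Uniform convexity with one of the two vectors in the ball instead of the sphere: if the sum is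
  almost of norm two, both norms are almost one and normalization moves \<open>z\<close> only slightly.
\<close>

lemma uniformly_convex_ball:
  assumes "uniformly_convex TYPE('x::real_normed_vector)" and "0 < \<epsilon>"
  obtains \<tau> where "0 < \<tau>" "\<tau> \<le> 1"
    "\<And>z x :: 'x. norm z \<le> 1 \<Longrightarrow> norm x = 1 \<Longrightarrow> 2 - \<tau> \<le> norm (z + x) \<Longrightarrow> norm (z - x) < \<epsilon>"
proof -
  obtain \<delta> where \<delta>: "0 < \<delta>" "\<delta> < 1"
    "\<And>z x :: 'x. norm z = 1 \<Longrightarrow> norm x = 1 \<Longrightarrow> norm (z + x) / 2 > 1 - \<delta> \<Longrightarrow> norm (z - x) < \<epsilon> / 2"
    using assms unfolding uniformly_convex_def by (metis half_gt_zero)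
  define \<tau> where "\<tau> = min (\<delta> / 2) (\<epsilon> / 2)"
  have \<tau>: "0 < \<tau>" "\<tau> < \<delta>" "\<tau> \<le> \<epsilon> / 2"
    using \<delta>(1) assms(2) by (auto simp: \<tau>_def)
  have "norm (z - x) < \<epsilon>" if z: "norm z \<le> 1" and x: "norm x = 1" and zx: "2 - \<tau> \<le> norm (z + x)"
    for z x :: 'x
  proof -
    have nz: "1 - \<tau> \<le> norm z"
      using norm_triangle_ineq[of z x] x zx by simp
    then have "z \<noteq> 0" using \<tau>(2) \<delta>(2) by auto
    define z' where "z' = (1 / norm z) *\<^sub>R z"
    have z': "norm z' = 1"
      using \<open>z \<noteq> 0\<close> by (simp add: z'_def)
    have "z = norm z *\<^sub>R z'"
      using \<open>z \<noteq> 0\<close> by (simp add: z'_def)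
    then have "z' - z = (1 - norm z) *\<^sub>R z'"
      by (metis scaleR_left_diff_distrib scaleR_one)
    then have dist: "norm (z' - z) = 1 - norm z"
      using z z' by simp
    have "norm (z + x) \<le> norm (z' + x) + norm (z' - z)"
      using norm_triangle_ineq4[of "z' + x" "z' - z"] by (simp add: add.commute)
    then have "1 - \<tau> \<le> norm (z' + x) / 2"
      using dist nz zx by simp
    then have "norm (z' - x) < \<epsilon> / 2"
      using \<delta>(3)[OF z' x] \<tau>(2) by simp
    moreover have "norm (z - x) \<le> norm (z' - x) + norm (z' - z)"
      using norm_triangle_ineq4[of "z' - x" "z' - z"] by simp
    ultimately show ?thesis
      using dist nz \<tau>(3) by linarith
  qed
  then show thesis
    using \<tau> \<delta>(2) by (intro that[of \<tau>]) auto
qed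

context operator_setting
begin

text \<open>
  After rotating \<open>z\<close> and \<open>x\<close> so that \<open>g\<close> is positive on both, \<open>g\<close> bounds the norm of their sum from below
  by \<open>\<bar>g z\<bar> + 1\<close>, so uniform convexity applies.
\<close>

lemma functional_slice_small:
  assumes "uniformly_convex TYPE('x)" and "0 < \<epsilon>"
  obtains \<tau> where "0 < \<tau>" "\<tau> \<le> 1"
    "\<And>g x z. g \<in> functionals \<Longrightarrow> (\<And>w. cmod (blinfun_apply g w) \<le> norm w) \<Longrightarrow>
       norm x = 1 \<Longrightarrow> cmod (blinfun_apply g x) = 1 \<Longrightarrow>
       norm z \<le> 1 \<Longrightarrow> 1 - \<tau> \<le> cmod (blinfun_apply g z) \<Longrightarrow>
       \<exists>c. norm c = 1 \<and> norm (z - sX c x) < \<epsilon>"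
proof -
  obtain \<tau> where \<tau>: "0 < \<tau>" "\<tau> \<le> 1"
    "\<And>z x :: 'x. norm z \<le> 1 \<Longrightarrow> norm x = 1 \<Longrightarrow> 2 - \<tau> \<le> norm (z + x) \<Longrightarrow> norm (z - x) < \<epsilon>"
    using uniformly_convex_ball[OF assms] by blast
  have "\<exists>c. norm c = 1 \<and> norm (z - sX c x) < \<epsilon>"
    if g: "g \<in> functionals" "\<And>w. cmod (blinfun_apply g w) \<le> norm w"
      and x: "norm x = 1" "cmod (blinfun_apply g x) = 1"
      and z: "norm z \<le> 1" "1 - \<tau> \<le> cmod (blinfun_apply g z)" for g x z
  proof -
    obtain a where a: "norm a = 1" "\<phi> a * g z = of_real (cmod (g z))"
      using embed_phase[OF functional_range[OF g(1)]] by blast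
    obtain b where b: "norm b = 1" "\<phi> b * g x = of_real (cmod (g x))"
      using embed_phase[OF functional_range[OF g(1)]] by blast
    have "blinfun_apply g (sX a z + sX b x) = of_real (cmod (g z) + 1)"
      by (simp add: blinfun.add_right functional_scale[OF g(1)] a(2) b(2) x(2))
    then have "cmod (blinfun_apply g (sX a z + sX b x)) = \<bar>cmod (g z) + 1\<bar>"
      by (simp only: norm_of_real)
    then have "2 - \<tau> \<le> norm (sX a z + sX b x)"
      using g(2)[of "sX a z + sX b x"] z(2) by simp
    then have lt: "norm (sX a z - sX b x) < \<epsilon>"
      using x z a b by (intro \<tau>(3)) (auto simp: X.norm_scale)
    have "a \<noteq> 0" using a by auto
    then have "sX a z - sX b x = sX a (z - sX (b / a) x)"
      by (simp add: X.scale_right_diff_distrib)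
    with lt have "norm (z - sX (b / a) x) < \<epsilon>"
      by (simp add: X.norm_scale a(1))
    with a b show ?thesis
      by (intro exI[of _ "b / a"]) (simp add: norm_divide)
  qed
  with \<tau>(1,2) show thesis by (intro that) auto
qed

end

section \<open>Strong maximizers\<close>

definition near_max :: "('x::real_normed_vector \<Rightarrow> real) \<Rightarrow> real \<Rightarrow> 'x set" where
  "near_max p \<theta> = {z. norm z \<le> 1 \<and> (\<forall>w. norm w \<le> 1 \<longrightarrow> p w \<le> p z + \<theta>)}"

lemma near_max_mono: "\<theta> \<le> \<theta>' \<Longrightarrow> near_max p \<theta> \<subseteq> near_max p \<theta>'"
  by (force simp: near_max_def)

lemma near_max_nonempty:
  assumes "\<And>z. norm z \<le> 1 \<Longrightarrow> p z \<le> K" and "0 < \<theta>"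
  shows "near_max p \<theta> \<noteq> {}"
proof -
  let ?M = "SUP z\<in>cball 0 1. p z"
  have bdd: "bdd_above (p ` cball 0 1)"
    using assms(1) by (intro bdd_aboveI2) auto
  have "p ` cball 0 1 \<noteq> {}" by simp
  moreover have "?M - \<theta> < ?M" using assms(2) by simp
  ultimately obtain z where z: "z \<in> cball 0 1" "?M - \<theta> < p z"
    using less_cSUP_iff[OF _ bdd] by (metis image_is_empty)
  have "p w \<le> p z + \<theta>" if "norm w \<le> 1" for w
  proof -
    have "p w \<le> ?M" using that by (intro cSUP_upper[OF _ bdd]) simp
    with z(2) show ?thesis by simp
  qed
  with z(1) show ?thesis by (auto simp: near_max_def)
qed

lemma near_max_close:
  assumes "\<And>z. norm z \<le> 1 \<Longrightarrow> \<bar>p z - q z\<bar> \<le> \<delta>"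
  shows "near_max p \<theta> \<subseteq> near_max q (\<theta> + 2 * \<delta>)"
proof
  fix z
  assume z: "z \<in> near_max p \<theta>"
  have "q w \<le> q z + (\<theta> + 2 * \<delta>)" if "norm w \<le> 1" for w
  proof -
    have "p w \<le> p z + \<theta>" "norm z \<le> 1"
      using z that by (auto simp: near_max_def)
    with assms[of w] assms[of z] that show ?thesis by (auto simp: abs_le_iff)
  qed
  with z show "z \<in> near_max q (\<theta> + 2 * \<delta>)"
    by (auto simp: near_max_def)
qed

lemma convergent_of_geometric_steps:
  fixes z :: "nat \<Rightarrow> 'x::banach"
  assumes "\<And>n. norm (z (Suc n) - z n) \<le> (1 / 2) ^ n"
  shows "convergent z"
proof -
  have "summable (\<lambda>n. z (Suc n) - z n)"
    using assms by (intro summable_comparison_test'[OF summable_geometric[of "1/2"]]) auto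
  then have "convergent (\<lambda>n. \<Sum>i<n. z (Suc i) - z i)"
    by (simp add: summable_iff_convergent)
  then have "convergent (\<lambda>n. z n - z 0)"
    by (simp add: sum_lessThan_telescope)
  then show ?thesis
    using convergent_diff_const_right_iff[of "\<lambda>n. z n" "z 0"] by simp
qed

context operator_setting
begin

text \<open>
  The seminorm that is maximized in place of \<open>\<parallel>T z\<parallel>\<close>. A rank-one perturbation of \<open>T\<close> realizes
  its supremum as an operator norm.
\<close>

definition tilted_norm :: "('x \<Rightarrow>\<^sub>L 'y) \<Rightarrow> ('x \<Rightarrow>\<^sub>L complex) \<Rightarrow> 'x \<Rightarrow> real" where
  "tilted_norm T h z = norm (blinfun_apply T z) + cmod (blinfun_apply h z)"

lemma tilted_norm_scaleR: "tilted_norm T h (r *\<^sub>R z) = \<bar>r\<bar> * tilted_norm T h z"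
  by (simp add: tilted_norm_def blinfun.scaleR_right distrib_left norm_mult)

lemma tilted_norm_nonneg: "0 \<le> tilted_norm T h z"
  by (simp add: tilted_norm_def)

lemma tilted_norm_le: "norm z \<le> 1 \<Longrightarrow> tilted_norm T h z \<le> norm T + norm h"
  unfolding tilted_norm_def
  by (intro add_mono order_trans[OF norm_blinfun] mult_left_le) auto

lemma tilted_norm_perturb:
  assumes "norm z \<le> 1"
  shows "\<bar>tilted_norm T h z - tilted_norm T h' z\<bar> \<le> norm (h - h')"
proof -
  have "\<bar>tilted_norm T h z - tilted_norm T h' z\<bar> \<le> cmod (blinfun_apply (h - h') z)"
    by (simp add: tilted_norm_def blinfun.diff_left norm_triangle_ineq3)
  also have "\<dots> \<le> norm (h - h') * norm z" by (rule norm_blinfun)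
  also have "\<dots> \<le> norm (h - h')" using assms by (simp add: mult_left_le)
  finally show ?thesis .
qed

lemma tilted_norm_scale:
  assumes "T \<in> bounded_operators sX sY" "h \<in> functionals"
  shows "tilted_norm T h (sX c z) = norm c * tilted_norm T h z"
proof -
  have lin: "Vector_Spaces.linear sX sY (blinfun_apply T)"
    using assms(1) by (simp add: bounded_operators_def)
  then show ?thesis
    by (simp add: tilted_norm_def module_hom.scale[OF lin[unfolded Vector_Spaces.linear_def, THEN conjunct2, THEN conjunct2]] functional_scale[OF assms(2)] Y.norm_scale norm_mult
        cmod_embed distrib_left)
qed

lemma tendsto_tilted_norm: "(z \<longlongrightarrow> l) F \<Longrightarrow> ((\<lambda>n. tilted_norm T h (z n)) \<longlongrightarrow> tilted_norm T h l) F"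
  unfolding tilted_norm_def by (intro tendsto_intros)

lemma unit_near_max:
  fixes x0 :: 'x
  assumes "norm x0 = 1" and "0 < \<theta>"
  obtains x where "norm x = 1" "x \<in> near_max (tilted_norm T h) \<theta>"
proof -
  obtain z where z: "z \<in> near_max (tilted_norm T h) \<theta>"
    using near_max_nonempty[of "tilted_norm T h" "norm T + norm h" \<theta>] tilted_norm_le assms(2) by blast
  define x where "x = (if z = 0 then x0 else (1 / norm z) *\<^sub>R z)"
  have "tilted_norm T h z \<le> tilted_norm T h x"
  proof (cases "z = 0")
    case True
    then show ?thesis by (simp add: x_def tilted_norm_nonneg) (simp add: tilted_norm_def)
  next
    case False
    have "norm z \<le> 1" using z by (simp add: near_max_def)
    then have "tilted_norm T h z \<le> tilted_norm T h z / norm z"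
      using False by (simp add: le_divide_eq mult_left_le tilted_norm_nonneg)
    with False show ?thesis by (simp add: x_def tilted_norm_scaleR)
  qed
  moreover have "norm x = 1" using assms(1) by (simp add: x_def)
  ultimately show thesis using z
    by (intro that[of x]) (force simp: near_max_def)+
qed

text \<open>
  A functional that lies in these sets for all \<open>\<epsilon> > 0\<close> gives the tilted norm a strong maximum, up to
  unimodular scalars.
\<close>

definition nearly_exposing :: "('x \<Rightarrow>\<^sub>L 'y) \<Rightarrow> real \<Rightarrow> ('x \<Rightarrow>\<^sub>L complex) set" where
  "nearly_exposing T \<epsilon> = {h \<in> functionals. \<exists>\<theta>>0. \<forall>z\<in>near_max (tilted_norm T h) \<theta>. \<forall>w\<in>near_max (tilted_norm T h) \<theta>.
     \<exists>c. norm c = 1 \<and> norm (z - sX c w) < \<epsilon>}"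

lemma nearly_exposing_mono: "\<epsilon> \<le> \<epsilon>' \<Longrightarrow> nearly_exposing T \<epsilon> \<subseteq> nearly_exposing T \<epsilon>'"
  unfolding nearly_exposing_def by clarsimp (meson less_le_trans)

lemma nearly_exposing_open:
  assumes "h \<in> nearly_exposing T \<epsilon>"
  obtains r where "0 < r" "\<And>h'. h' \<in> functionals \<Longrightarrow> norm (h' - h) < r \<Longrightarrow> h' \<in> nearly_exposing T \<epsilon>"
proof -
  obtain \<theta> where \<theta>: "0 < \<theta>" "\<And>z w. z \<in> near_max (tilted_norm T h) \<theta> \<Longrightarrow> w \<in> near_max (tilted_norm T h) \<theta> \<Longrightarrow>
     \<exists>c. norm c = 1 \<and> norm (z - sX c w) < \<epsilon>"
    using assms unfolding nearly_exposing_def by blast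
  have "h' \<in> nearly_exposing T \<epsilon>" if h': "h' \<in> functionals" "norm (h' - h) < \<theta> / 3" for h'
  proof -
    have "near_max (tilted_norm T h') (\<theta> / 3) \<subseteq> near_max (tilted_norm T h) (\<theta> / 3 + 2 * (\<theta> / 3))"
      by (rule near_max_close) (use tilted_norm_perturb[of _ T h' h] h'(2) in force)
    also have "\<theta> / 3 + 2 * (\<theta> / 3) = \<theta>" by simp
    finally have "near_max (tilted_norm T h') (\<theta> / 3) \<subseteq> near_max (tilted_norm T h) \<theta>" .
    with \<theta> h'(1) show ?thesis
      unfolding nearly_exposing_def by (intro CollectI conjI exI[of _ "\<theta> / 3"]) auto
  qed
  with \<theta>(1) show thesis by (intro that[of "\<theta> / 3"]) auto
qed

text \<open>
  Density comes from tilting towards a near-maximizer \<open>x\<close>: adding \<open>d g'\<close>, with \<open>g'\<close> norming \<open>x\<close> in the phase of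
  \<open>h x\<close>, raises the value at \<open>x\<close> by the full amount \<open>d\<close>, whereas elsewhere it is raised by at most
  \<open>d \<bar>g z\<bar>\<close>. Near-maximizers must therefore lie in a thin slice of \<open>g\<close>.
\<close>

lemma nearly_exposing_dense:
  assumes uc: "uniformly_convex TYPE('x)" and "0 < \<epsilon>"
    and x0: "norm (x0 :: 'x) = 1" and h: "h \<in> functionals" and "0 < r"
  obtains h' where "h' \<in> nearly_exposing T \<epsilon>" "norm (h' - h) < r"
proof -
  obtain \<tau> where \<tau>: "0 < \<tau>" and slice:
    "\<And>g x z. g \<in> functionals \<Longrightarrow> (\<And>w. cmod (blinfun_apply g w) \<le> norm w) \<Longrightarrow>
       norm x = 1 \<Longrightarrow> cmod (blinfun_apply g x) = 1 \<Longrightarrow>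
       norm z \<le> 1 \<Longrightarrow> 1 - \<tau> \<le> cmod (blinfun_apply g z) \<Longrightarrow>
       \<exists>c. norm c = 1 \<and> norm (z - sX c x) < \<epsilon> / 2"
    using functional_slice_small[OF uc half_gt_zero[OF assms(2)]] by metis
  (* The slack of x as a near-maximizer and that of z add up to 2 * \<theta>, which must cost at most
     the fraction \<tau> of the gain d. *)
  define d \<theta> where "d = r / 2" and "\<theta> = \<tau> * d / 2"
  have d: "0 < d" "d < r" and \<theta>: "0 < \<theta>"
    using \<open>0 < r\<close> \<tau> by (auto simp: d_def \<theta>_def)
  obtain x where x: "norm x = 1" "x \<in> near_max (tilted_norm T h) \<theta>"
    using unit_near_max[OF x0 \<theta>] by blast
  obtain g where g: "g \<in> functionals" "\<And>z. cmod (blinfun_apply g z) \<le> norm z" "cmod (blinfun_apply g x) = 1"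
    using norming_functional[of x] x(1) by metis
  obtain a where a: "norm a = 1" "\<phi> a * h x = of_real (cmod (h x))"
    using embed_phase[OF functional_range[OF h]] by blast
  obtain b where b: "norm b = 1" "\<phi> b * g x = of_real (cmod (g x))"
    using embed_phase[OF functional_range[OF g(1)]] by blast
  have "a \<noteq> 0" using a(1) by auto
  obtain g' where g': "g' \<in> functionals" "\<And>z. blinfun_apply g' z = \<phi> (b / a) * g z"
    using functionals_rotate[OF g(1)] by blast
  have cg': "cmod (blinfun_apply g' z) = cmod (g z)" for z
    by (simp add: g'(2) norm_mult cmod_embed norm_divide a(1) b(1))
  define h' where "h' = h + d *\<^sub>R g'"
  have h': "h' \<in> functionals"
    unfolding h'_def by (intro functionals_add functionals_scaleR h g')
  have "norm g' \<le> 1"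
    using g(2) by (intro norm_blinfun_bound) (auto simp: cg')
  then have "d * norm g' \<le> d * 1"
    using d by (intro mult_left_mono) auto
  moreover have "norm (h' - h) = d * norm g'"
    using d by (simp add: h'_def)
  ultimately have close: "norm (h' - h) < r"
    using d by linarith
  have "\<phi> a * h' x = of_real (cmod (h x) + d)"
  proof -
    have "\<phi> a * g' x = \<phi> (a * (b / a)) * g x"
      by (simp only: g'(2) embed_mult mult.assoc)
    also have "\<dots> = 1"
      using \<open>a \<noteq> 0\<close> by (simp add: b(2) g(3))
    finally show ?thesis
      by (simp add: h'_def blinfun.add_left blinfun.scaleR_left distrib_left a(2)
          scaleR_conv_of_real)
  qed
  then have "cmod (\<phi> a * h' x) = \<bar>cmod (h x) + d\<bar>"
    by (simp only: norm_of_real)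
  then have top: "tilted_norm T h' x = tilted_norm T h x + d"
    using d a(1) by (simp add: tilted_norm_def norm_mult cmod_embed)
  have near: "\<exists>c. norm c = 1 \<and> norm (z - sX c x) < \<epsilon> / 2" if z: "z \<in> near_max (tilted_norm T h') \<theta>" for z
  proof -
    have nz: "norm z \<le> 1" using z by (simp add: near_max_def)
    have "tilted_norm T h x + d \<le> tilted_norm T h' z + \<theta>"
      using z x(1) unfolding top[symmetric] by (simp add: near_max_def)
    also have "tilted_norm T h' z \<le> tilted_norm T h z + d * cmod (g z)"
      using d norm_triangle_ineq[of "blinfun_apply h z" "d *\<^sub>R blinfun_apply g' z"]
      by (simp add: tilted_norm_def h'_def blinfun.add_left blinfun.scaleR_left cg' norm_mult)
    also have "tilted_norm T h z \<le> tilted_norm T h x + \<theta>"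
      using x(2) nz by (simp add: near_max_def)
    finally have "d * (1 - \<tau>) \<le> d * cmod (g z)"
      by (simp add: \<theta>_def algebra_simps)
    then have "1 - \<tau> \<le> cmod (g z)"
      using d by simp
    then show ?thesis
      by (rule slice[OF g(1,2) x(1) g(3) nz])
  qed
  have "\<exists>c. norm c = 1 \<and> norm (z - sX c w) < \<epsilon>"
    if zw: "z \<in> near_max (tilted_norm T h') \<theta>" "w \<in> near_max (tilted_norm T h') \<theta>" for z w
  proof -
    obtain c where c: "norm c = 1" "norm (z - sX c x) < \<epsilon> / 2"
      using near[OF zw(1)] by blast
    obtain e where e: "norm e = 1" "norm (w - sX e x) < \<epsilon> / 2"
      using near[OF zw(2)] by blast
    have "e \<noteq> 0" using e(1) by auto
    have "z - sX (c / e) w = (z - sX c x) - sX (c / e) (w - sX e x)"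
      using \<open>e \<noteq> 0\<close> by (simp add: X.scale_right_diff_distrib)
    then have "norm (z - sX (c / e) w) \<le> norm (z - sX c x) + norm (sX (c / e) (w - sX e x))"
      by (metis norm_triangle_ineq4)
    also have "norm (sX (c / e) (w - sX e x)) = norm (w - sX e x)"
      by (simp add: X.norm_scale norm_divide c(1) e(1))
    finally show ?thesis
      using c e by (intro exI[of _ "c / e"]) (auto simp: norm_divide)
  qed
  with h' \<theta> have "h' \<in> nearly_exposing T \<epsilon>"
    unfolding nearly_exposing_def by blast
  with close show thesis by (intro that)
qed

text \<open>
  Baire's theorem in the dual space, regarded as a complete metric space of its own.
\<close>

lemma exposing_dense:
  assumes uc: "uniformly_convex TYPE('x)"
    and x0: "norm (x0 :: 'x) = 1" and h: "h \<in> functionals" and "0 < r"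
  obtains h' where "\<And>\<epsilon>. 0 < \<epsilon> \<Longrightarrow> h' \<in> nearly_exposing T \<epsilon>" "norm (h' - h) < r"
proof -
  interpret F: Submetric UNIV dist functionals
    by unfold_locales simp
  have sub: "nearly_exposing T \<epsilon> \<subseteq> functionals" for \<epsilon>
    by (auto simp: nearly_exposing_def)
  have complete: "F.sub.mcomplete"
    by (rule F.closedin_mcomplete_imp_mcomplete) (simp_all add: closed_functionals complete_UNIV)
  have "openin F.sub.mtopology (nearly_exposing T \<epsilon>) \<and>
      F.sub.mtopology closure_of (nearly_exposing T \<epsilon>) = functionals" if "0 < \<epsilon>" for \<epsilon>
  proof
    show "openin F.sub.mtopology (nearly_exposing T \<epsilon>)"
      unfolding F.sub.openin_mtopology
    proof (intro conjI sub allI impI)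
      fix k
      assume k: "k \<in> nearly_exposing T \<epsilon>"
      obtain r where "0 < r" "\<And>h'. h' \<in> functionals \<Longrightarrow> norm (h' - k) < r \<Longrightarrow> h' \<in> nearly_exposing T \<epsilon>"
        using nearly_exposing_open[OF k] by blast
      then show "\<exists>r>0. F.sub.mball k r \<subseteq> nearly_exposing T \<epsilon>"
        by (intro exI[of _ r]) (auto simp: dist_norm norm_minus_commute)
    qed
    have "\<exists>y\<in>nearly_exposing T \<epsilon>. y \<in> F.sub.mball k r" if "k \<in> functionals" "0 < r" for k r
      using nearly_exposing_dense[OF uc \<open>0 < \<epsilon>\<close> x0 that, of T] sub that
      by (metis F.sub.in_mball dist_norm norm_minus_commute subsetD)
    then show "F.sub.mtopology closure_of (nearly_exposing T \<epsilon>) = functionals"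
      by (auto simp: F.sub.metric_closure_of)
  qed
  then have "F.sub.mtopology closure_of (\<Inter>n. nearly_exposing T (1 / real (Suc n))) = functionals"
    by (intro F.sub.metric_Baire_category complete) auto
  then have "\<exists>y\<in>\<Inter>n. nearly_exposing T (1 / real (Suc n)). y \<in> F.sub.mball h r"
    using h \<open>0 < r\<close> unfolding F.sub.metric_closure_of by blast
  then obtain h' where h': "\<And>n. h' \<in> nearly_exposing T (1 / real (Suc n))" "norm (h' - h) < r"
    by (auto simp: dist_norm norm_minus_commute)
  have "h' \<in> nearly_exposing T \<epsilon>" if \<epsilon>: "0 < \<epsilon>" for \<epsilon>
  proof -
    obtain n where "1 / real (Suc n) < \<epsilon>"
      using nat_approx_posE[OF \<epsilon>] by blast
    then show ?thesis
      using h'(1)[of n] nearly_exposing_mono[of "1 / real (Suc n)" \<epsilon> T] by auto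
  qed
  with h'(2) show thesis by (intro that)
qed

text \<open>
  The near-maximizers shrink to a single orbit of unimodular scalars. Completeness of \<open>X\<close> yields a
  point on it once the near-maximizers are rotated so as to form a Cauchy sequence.
\<close>

lemma exposed_maximizer:
  assumes T: "T \<in> bounded_operators sX sY"
    and h: "\<And>\<epsilon>. 0 < \<epsilon> \<Longrightarrow> h \<in> nearly_exposing T \<epsilon>"
  obtains x where "norm x \<le> 1" "\<And>w. norm w \<le> 1 \<Longrightarrow> tilted_norm T h w \<le> tilted_norm T h x"
    "\<And>\<epsilon>. 0 < \<epsilon> \<Longrightarrow> \<exists>\<theta>>0. \<forall>z\<in>near_max (tilted_norm T h) \<theta>. \<exists>c. norm c = 1 \<and> norm (z - sX c x) < \<epsilon>"
proof -
  let ?A = "near_max (tilted_norm T h)"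
  have hf: "h \<in> functionals"
    using h[of 1] by (simp add: nearly_exposing_def)
  have "\<exists>\<theta>>0. \<theta> \<le> 1 / real (Suc n) \<and>
      (\<forall>z\<in>?A \<theta>. \<forall>w\<in>?A \<theta>. \<exists>c. norm c = 1 \<and> norm (z - sX c w) < (1 / 2) ^ n)" for n
  proof -
    obtain \<theta> where \<theta>: "0 < \<theta>" "\<forall>z\<in>?A \<theta>. \<forall>w\<in>?A \<theta>. \<exists>c. norm c = 1 \<and> norm (z - sX c w) < (1 / 2) ^ n"
      using h[of "(1 / 2) ^ n"] by (auto simp: nearly_exposing_def)
    then show ?thesis
      using near_max_mono[of "min \<theta> (1 / real (Suc n))" \<theta> "tilted_norm T h"]
      by (intro exI[of _ "min \<theta> (1 / real (Suc n))"]) auto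
  qed
  then obtain \<theta> where \<theta>: "\<And>n. 0 < \<theta> n" "\<And>n. \<theta> n \<le> 1 / real (Suc n)"
    "\<And>n z w. z \<in> ?A (\<theta> n) \<Longrightarrow> w \<in> ?A (\<theta> n) \<Longrightarrow> \<exists>c. norm c = 1 \<and> norm (z - sX c w) < (1 / 2) ^ n"
    by metis
  (* The slacks need not decrease, so the n-th point has to respect all slacks up to n. *)
  have ex: "\<exists>z. \<forall>k\<le>n. z \<in> ?A (\<theta> k)" for n
  proof -
    have "0 < Min (\<theta> ` {..n})" using \<theta>(1) by simp
    then obtain z where z: "z \<in> ?A (Min (\<theta> ` {..n}))"
      using near_max_nonempty[of "tilted_norm T h" "norm T + norm h"] tilted_norm_le by blast
    have "z \<in> ?A (\<theta> k)" if "k \<le> n" for k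
    proof -
      have "Min (\<theta> ` {..n}) \<le> \<theta> k" using that by simp
      from near_max_mono[OF this] z show ?thesis by blast
    qed
    then show ?thesis by blast
  qed
  have rotate: "sX c z \<in> ?A \<eta>" if "norm c = 1" "z \<in> ?A \<eta>" for c z \<eta>
    using that by (simp add: near_max_def X.norm_scale tilted_norm_scale[OF T hf])
  have "\<exists>z'. (\<forall>k\<le>Suc n. z' \<in> ?A (\<theta> k)) \<and> norm (z' - z) \<le> (1 / 2) ^ n"
    if z: "\<forall>k\<le>n. z \<in> ?A (\<theta> k)" for n z
  proof -
    obtain w where w: "\<forall>k\<le>Suc n. w \<in> ?A (\<theta> k)" using ex by blast
    obtain c where c: "norm c = 1" "norm (z - sX c w) < (1 / 2) ^ n"
      using \<theta>(3)[of z n w] z w by auto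
    then show ?thesis
      using w rotate by (intro exI[of _ "sX c w"]) (auto simp: norm_minus_commute)
  qed
  then obtain z where z: "\<And>n. \<forall>k\<le>n. z n \<in> ?A (\<theta> k)" "\<And>n. norm (z (Suc n) - z n) \<le> (1 / 2) ^ n"
    using dependent_nat_choice[of "\<lambda>n z. \<forall>k\<le>n. z \<in> ?A (\<theta> k)" "\<lambda>n z z'. norm (z' - z) \<le> (1 / 2) ^ n",
        OF ex[of 0]]
    by metis
  obtain x where x: "z \<longlonglongrightarrow> x"
    using convergent_of_geometric_steps[OF z(2)] by (auto simp: convergent_def)
  have nz: "norm (z n) \<le> 1" for n
    using z(1)[of n] by (auto simp: near_max_def)
  have nx: "norm x \<le> 1"
    using LIMSEQ_le_const2[OF tendsto_norm[OF x]] nz by blast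
  have max: "tilted_norm T h w \<le> tilted_norm T h x" if w: "norm w \<le> 1" for w
  proof (rule LIMSEQ_le_const)
    show "(\<lambda>n. tilted_norm T h (z n) + 1 / real (Suc n)) \<longlonglongrightarrow> tilted_norm T h x"
      using tendsto_add[OF tendsto_tilted_norm[OF x] LIMSEQ_inverse_real_of_nat]
      by (simp add: inverse_eq_divide)
    have "tilted_norm T h w \<le> tilted_norm T h (z n) + \<theta> n" for n
      using z(1)[of n] w by (auto simp: near_max_def)
    then show "\<exists>N. \<forall>n\<ge>N. tilted_norm T h w \<le> tilted_norm T h (z n) + 1 / real (Suc n)"
      using \<theta>(2) by (meson add_left_mono order_trans)
  qed
  have "x \<in> ?A \<eta>" if "0 < \<eta>" for \<eta>
    using nx max that by (force simp: near_max_def intro: order_trans)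
  then have "\<exists>\<eta>>0. \<forall>w\<in>?A \<eta>. \<exists>c. norm c = 1 \<and> norm (w - sX c x) < \<epsilon>" if "0 < \<epsilon>" for \<epsilon>
    using h[OF that] by (auto simp: nearly_exposing_def)
  with nx max show thesis by (intro that)
qed

section \<open>Rank-one perturbations\<close>

lemma rank_one_operator:
  assumes h: "h \<in> functionals"
  obtains R \<kappa> where "R \<in> finite_rank_operators sX sY"
    "\<And>z. blinfun_apply R z = sY (\<kappa> z) y" "\<And>z. \<phi> (\<kappa> z) = blinfun_apply h z"
proof -
  have "\<forall>z. \<exists>a. \<phi> a = blinfun_apply h z"
    using functional_range[OF h] by (metis rangeE)
  then obtain \<kappa> where \<kappa>: "\<And>z. \<phi> (\<kappa> z) = blinfun_apply h z" by metis
  have add: "\<kappa> (w + z) = \<kappa> w + \<kappa> z" for w z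
    by (simp flip: embed_eq_iff add: embed_add \<kappa> blinfun.add_right)
  have scale: "\<kappa> (sX a z) = a * \<kappa> z" for a z
    by (simp flip: embed_eq_iff add: embed_mult \<kappa> functional_scale[OF h])
  have norm: "norm (\<kappa> z) = cmod (h z)" for z
    by (metis cmod_embed \<kappa>)
  have "bounded_linear (\<lambda>z. sY (\<kappa> z) y)"
  proof (rule bounded_linear_intro[where K = "norm h * norm y"])
    fix r :: real and z
    have "r *\<^sub>R z = sX (of_real r) z" by (simp add: X.scale_of_real)
    then show "sY (\<kappa> (r *\<^sub>R z)) y = r *\<^sub>R sY (\<kappa> z) y"
      by (simp add: scale flip: Y.scale_of_real)
  next
    fix z
    have "cmod (h z) * norm y \<le> norm h * norm z * norm y"
      by (intro mult_right_mono norm_blinfun) simp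
    then show "norm (sY (\<kappa> z) y) \<le> norm z * (norm h * norm y)"
      by (simp add: Y.norm_scale norm mult_ac)
  qed (simp add: add Y.scale_left_distrib)
  then have app: "blinfun_apply (Blinfun (\<lambda>z. sY (\<kappa> z) y)) = (\<lambda>z. sY (\<kappa> z) y)"
    by (rule bounded_linear_Blinfun_apply)
  let ?R = "Blinfun (\<lambda>z. sY (\<kappa> z) y)"
  have "range (blinfun_apply ?R) \<subseteq> Y.span {y}"
    by (auto simp: app intro: Y.span_scale Y.span_base)
  moreover have "?R \<in> bounded_operators sX sY"
    by (simp add: bounded_operators_def Vector_Spaces.linear_iff app add scale
        Y.scale_left_distrib X.vector_space_axioms Y.vector_space_axioms)
  ultimately have "?R \<in> finite_rank_operators sX sY"
    unfolding finite_rank_operators_def by (auto intro: exI[of _ "{y}"])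
  with \<kappa> app show thesis by (intro that) auto
qed

text \<open>
  \<open>R\<close> sends \<open>x\<close> in the direction of \<open>T x\<close>, the scalar \<open>k\<close> correcting the phase of \<open>h x\<close>, so that the norms of \<open>T x\<close>
  and \<open>R x\<close> add up. The triangle inequality bounds \<open>T + R\<close> by the tilted norm everywhere else.
\<close>

lemma rank_one_perturbation_attains_norm:
  fixes T :: "'x \<Rightarrow>\<^sub>L 'y"
  assumes h: "h \<in> functionals" and nx: "norm x = 1"
    and max: "\<And>w. norm w \<le> 1 \<Longrightarrow> tilted_norm T h w \<le> tilted_norm T h x"
    and Tx: "blinfun_apply T x \<noteq> 0"
  obtains R where "R \<in> finite_rank_operators sX sY" "\<And>z. norm (blinfun_apply R z) = cmod (h z)"
    "norm (blinfun_apply (T + R) x) = tilted_norm T h x" "norm (T + R) = tilted_norm T h x"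
proof -
  define y where "y = (1 / norm (blinfun_apply T x)) *\<^sub>R T x"
  have y: "norm y = 1" "blinfun_apply T x = norm (blinfun_apply T x) *\<^sub>R y"
    using Tx by (auto simp: y_def)
  obtain k where k: "norm k = 1" "\<phi> k * h x = of_real (cmod (h x))"
    using embed_phase[OF functional_range[OF h]] by blast
  obtain R \<kappa> where R: "R \<in> finite_rank_operators sX sY"
    "\<And>z. blinfun_apply R z = sY (\<kappa> z) (sY k y)" "\<And>z. \<phi> (\<kappa> z) = blinfun_apply h z"
    using rank_one_operator[OF h, of "sY k y"] by blast
  have nR: "norm (blinfun_apply R z) = cmod (h z)" for z
    by (simp add: R(2) Y.norm_scale norm_mult k(1) y(1) cmod_embed flip: R(3))
  have Rx: "blinfun_apply R x = cmod (h x) *\<^sub>R y"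
  proof -
    have "\<kappa> x * k = of_real (cmod (h x))"
      using k(2) by (simp flip: embed_eq_iff add: embed_mult R(3) embed_of_real mult.commute)
    then show ?thesis by (simp add: R(2) Y.scale_of_real)
  qed
  have "blinfun_apply (T + R) x = (norm (blinfun_apply T x) + cmod (h x)) *\<^sub>R y"
    using y(2) by (simp add: blinfun.add_left Rx scaleR_left_distrib)
  then have attained: "norm (blinfun_apply (T + R) x) = tilted_norm T h x"
    by (simp add: y(1) tilted_norm_def)
  have "norm (T + R) = tilted_norm T h x"
  proof (rule antisym)
    have "norm (blinfun_apply (T + R) z) \<le> tilted_norm T h z" for z
      using norm_triangle_ineq[of "blinfun_apply T z" "blinfun_apply R z"]
      by (simp add: tilted_norm_def blinfun.add_left nR)
    moreover have "tilted_norm T h z \<le> tilted_norm T h x * norm z" for z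
    proof (cases "z = 0")
      case False
      then have "tilted_norm T h ((1 / norm z) *\<^sub>R z) \<le> tilted_norm T h x"
        by (intro max) simp
      with False show ?thesis by (simp add: tilted_norm_scaleR divide_le_eq)
    qed (simp add: tilted_norm_def)
    ultimately show "norm (T + R) \<le> tilted_norm T h x"
      by (intro norm_blinfun_bound tilted_norm_nonneg) (blast intro: order_trans)
    show "tilted_norm T h x \<le> norm (T + R)"
      using norm_blinfun[of "T + R" x] attained nx by simp
  qed
  with R(1) nR attained show thesis by (rule that)
qed

text \<open>
  The exposition condition gives, along a subsequence, scalars \<open>c n\<close> with \<open>z n\<close> close to \<open>c n x\<close>. The
  unimodular scalars form a compact set, so a further subsequence of the \<open>c n\<close> converges.
\<close>

lemma ASE_I:
  assumes S: "S \<in> bounded_operators sX sY" and x: "norm x = 1"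
    and exposed: "\<And>\<epsilon>. 0 < \<epsilon> \<Longrightarrow> \<exists>\<theta>>0. \<forall>z. norm z \<le> 1 \<longrightarrow> norm S - \<theta> < norm (blinfun_apply S z) \<longrightarrow>
      (\<exists>c. norm c = 1 \<and> norm (z - sX c x) < \<epsilon>)"
  shows "S \<in> ASE sX sY"
proof -
  have "\<exists>\<sigma> c. strict_mono \<sigma> \<and> norm c = 1 \<and> (\<lambda>n. z (\<sigma> n)) \<longlonglongrightarrow> sX c x"
    if nz: "\<And>n. norm (z n) \<le> 1" and lim: "(\<lambda>n. norm (blinfun_apply S (z n))) \<longlonglongrightarrow> norm S"
    for z :: "nat \<Rightarrow> 'x"
  proof -
    have ev: "eventually (\<lambda>n. \<exists>c. norm c = 1 \<and> norm (z n - sX c x) < \<epsilon>) sequentially"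
      if \<epsilon>: "0 < \<epsilon>" for \<epsilon>
    proof -
      obtain \<theta> where \<theta>: "0 < \<theta>" "\<And>z. norm z \<le> 1 \<Longrightarrow> norm S - \<theta> < norm (blinfun_apply S z) \<Longrightarrow>
          \<exists>c. norm c = 1 \<and> norm (z - sX c x) < \<epsilon>"
        using exposed[OF \<epsilon>] by blast
      have "eventually (\<lambda>n. norm S - \<theta> < norm (blinfun_apply S (z n))) sequentially"
        using \<theta>(1) by (intro order_tendstoD(1)[OF lim]) simp
      then show ?thesis
        by (rule eventually_mono) (intro \<theta>(2) nz)
    qed
    have next_index: "\<exists>m>n. \<exists>c. norm c = 1 \<and> norm (z m - sX c x) < 1 / real (Suc k)" for n k
    proof -
      have "0 < 1 / real (Suc k)" by simp
      from eventually_conj[OF ev[OF this] eventually_gt_at_top[of n]]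
      show ?thesis
        using eventually_happens'[OF sequentially_bot] by blast
    qed
    define P where "P = (\<lambda>k (m, c). norm c = 1 \<and> norm (z m - sX c x) < 1 / real (Suc k))"
    have "\<exists>f. \<forall>k. P k (f k) \<and> fst (f k) < fst (f (Suc k))"
    proof (rule dependent_nat_choice)
      show "\<exists>p. P 0 p"
        using next_index[of 0 0] by (auto simp: P_def)
      show "\<exists>q. P (Suc k) q \<and> fst p < fst q" for p k
        using next_index[of "fst p" "Suc k"] by (auto simp: P_def)
    qed
    then obtain f where f: "\<And>k. P k (f k)" "\<And>k. fst (f k) < fst (f (Suc k))" by blast
    define \<sigma> c where "\<sigma> k = fst (f k)" and "c k = snd (f k)" for k
    have \<sigma>: "strict_mono \<sigma>"
      using f(2) by (simp add: strict_mono_Suc_iff \<sigma>_def)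
    have c: "norm (c k) = 1" "norm (z (\<sigma> k) - sX (c k) x) < 1 / real (Suc k)" for k
      using f(1)[of k] by (auto simp: P_def \<sigma>_def c_def split: prod.splits)
    obtain \<rho> l where \<rho>: "strict_mono \<rho>" "norm l = 1" "(\<lambda>n. c (\<rho> n)) \<longlonglongrightarrow> l"
      using unimodular_convergent_subseq[of c] c(1) by blast
    have "(\<lambda>k. z (\<sigma> k) - sX (c k) x) \<longlonglongrightarrow> 0"
      using c(2) by (rule LIMSEQ_norm_0)
    from LIMSEQ_subseq_LIMSEQ[OF this \<rho>(1)]
    have "(\<lambda>k. z (\<sigma> (\<rho> k)) - sX (c (\<rho> k)) x) \<longlonglongrightarrow> 0"
      by (simp add: o_def)
    moreover have "(\<lambda>k. sX (c (\<rho> k)) x - sX l x) \<longlonglongrightarrow> 0"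
    proof (rule tendsto_norm_zero_cancel)
      have "norm (sX (c (\<rho> k)) x - sX l x) = norm (c (\<rho> k) - l)" for k
        by (simp add: x X.norm_scale flip: X.scale_left_diff_distrib)
      then show "(\<lambda>k. norm (sX (c (\<rho> k)) x - sX l x)) \<longlonglongrightarrow> 0"
        using tendsto_norm_zero[OF LIM_zero[OF \<rho>(3)]] by simp
    qed
    ultimately have "(\<lambda>k. (z (\<sigma> (\<rho> k)) - sX (c (\<rho> k)) x) + (sX (c (\<rho> k)) x - sX l x)) \<longlonglongrightarrow> 0 + 0"
      by (rule tendsto_add)
    then have "(\<lambda>k. z ((\<sigma> \<circ> \<rho>) k) - sX l x) \<longlonglongrightarrow> 0"
      by simp
    then have "(\<lambda>k. z ((\<sigma> \<circ> \<rho>) k)) \<longlonglongrightarrow> sX l x"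
      by (rule LIM_zero_cancel)
    with strict_mono_o[OF \<sigma> \<rho>(1)] \<rho>(2) show ?thesis by blast
  qed
  with S x show ?thesis unfolding ASE_def by blast
qed

section \<open>The Bishop-Phelps-Bollobas property\<close>

text \<open>
  Tilting \<open>T\<close> by a functional close to \<open>d g\<close>, with \<open>g\<close> norming \<open>x\<close>, forces the maximizer \<open>x0\<close> into a thin slice of
  \<open>g\<close>, hence near the orbit of \<open>x\<close>. The operator sought is \<open>T + R\<close> divided by its norm \<open>N\<close>, which lies between \<open>1\<close>
  and \<open>1 + d + \<eta>\<close>.
\<close>

lemma subspace_has_BPBp_ASE:
  assumes uc: "uniformly_convex TYPE('x)"
    and M: "linear_subspace_of_operators sX sY M" "finite_rank_operators sX sY \<subseteq> M"
  shows "has_BPBp_ASE sX sY M"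
  unfolding has_BPBp_ASE_def
proof (intro allI impI)
  interpret O: banach_over "scale_op sY :: 'k \<Rightarrow> ('x \<Rightarrow>\<^sub>L 'y) \<Rightarrow> _"
    by (rule Y.banach_over_scale_op)
  have MB: "M \<subseteq> bounded_operators sX sY" and Msub: "O.subspace M"
    using M(1) by (auto simp: linear_subspace_of_operators_def)
  have M_scaleR: "r *\<^sub>R U \<in> M" if "U \<in> M" for r U
    using O.subspace_scale[OF Msub that, of "of_real r"] by (simp add: O.scale_of_real)
  fix \<epsilon> :: real
  assume \<epsilon>: "0 < \<epsilon>"
  obtain \<tau> where \<tau>: "0 < \<tau>" "\<tau> \<le> 1" and slice:
    "\<And>g x z. g \<in> functionals \<Longrightarrow> (\<And>w. cmod (blinfun_apply g w) \<le> norm w) \<Longrightarrow>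
       norm x = 1 \<Longrightarrow> cmod (blinfun_apply g x) = 1 \<Longrightarrow>
       norm z \<le> 1 \<Longrightarrow> 1 - \<tau> \<le> cmod (blinfun_apply g z) \<Longrightarrow>
       \<exists>c. norm c = 1 \<and> norm (z - sX c x) < \<epsilon>"
    using functional_slice_small[OF uc \<epsilon>] by metis
  (* The choice d <= 1/4 keeps T x0 away from 0, and d <= \<epsilon>/4 bounds the total change 2 * (d + \<eta>) by \<epsilon>.
     Three errors \<eta> occur in the estimate of g x0 (one from T x, two from approximating d g), which
     may use up the fraction \<tau> of d. *)
  define d where "d = min (1 / 4) (\<epsilon> / 4)"
  define \<eta> where "\<eta> = \<tau> * d / 3"
  have d: "0 < d" "d \<le> 1 / 4" "d \<le> \<epsilon> / 4" using \<epsilon> by (auto simp: d_def)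
  have "\<tau> * d \<le> 1 * d" using \<tau> d by (intro mult_right_mono) auto
  then have \<eta>: "0 < \<eta>" "\<eta> \<le> d / 3" using \<tau>(1) d(1) by (auto simp: \<eta>_def)
  have main: "\<exists>S\<in>ASE sX sY \<inter> M. \<exists>x0. norm x0 = 1 \<and> norm S = 1 \<and> norm (blinfun_apply S x0) = 1 \<and>
      norm (S - T) < \<epsilon> \<and> norm (x - x0) < \<epsilon>"
    if TM: "T \<in> M" and nT: "norm T = 1" and x: "norm x = 1" and Tx: "1 - \<eta> < norm (blinfun_apply T x)"
    for T x
  proof -
    have TB: "T \<in> bounded_operators sX sY" using TM MB by blast
    obtain g where g: "g \<in> functionals" "\<And>z. cmod (blinfun_apply g z) \<le> norm z"
      "cmod (blinfun_apply g x) = 1"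
      using norming_functional[of x] x by metis
    obtain h where h: "\<And>\<epsilon>. 0 < \<epsilon> \<Longrightarrow> h \<in> nearly_exposing T \<epsilon>" "norm (h - d *\<^sub>R g) < \<eta>"
      using exposing_dense[OF uc x functionals_scaleR[OF g(1)] \<eta>(1)] by metis
    have hf: "h \<in> functionals"
      using h(1)[of 1] by (simp add: nearly_exposing_def)
    obtain x0 where x0: "norm x0 \<le> 1" "\<And>w. norm w \<le> 1 \<Longrightarrow> tilted_norm T h w \<le> tilted_norm T h x0"
      and exposed: "\<And>\<epsilon>. 0 < \<epsilon> \<Longrightarrow> \<exists>\<theta>>0. \<forall>z\<in>near_max (tilted_norm T h) \<theta>. \<exists>c. norm c = 1 \<and> norm (z - sX c x0) < \<epsilon>"
      using exposed_maximizer[OF TB h(1)] by metis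
    (* N is going to be the norm of T + R. *)
    define N where "N = tilted_norm T h x0"
    have tilted_norm_near: "\<bar>tilted_norm T h z - (norm (blinfun_apply T z) + d * cmod (g z))\<bar> \<le> \<eta>"
      if "norm z \<le> 1" for z
      using tilted_norm_perturb[OF that, of T h "d *\<^sub>R g"] h(2) d(1)
      by (simp add: tilted_norm_def blinfun.scaleR_left norm_mult)
    have N_ge: "1 + d - 2 * \<eta> < N"
      using tilted_norm_near[of x] x0(2)[of x] Tx x g(3) by (simp add: N_def abs_le_iff)
    then have N1: "1 \<le> N" using \<eta> d by simp
    have Tx0: "norm (blinfun_apply T x0) \<le> 1"
      using norm_blinfun[of T x0] nT x0(1) by simp
    have "N \<le> 1 + d * cmod (g x0) + \<eta>"
      using tilted_norm_near[OF x0(1)] Tx0 by (simp add: N_def abs_le_iff)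
    with N_ge have "d * (1 - \<tau>) \<le> d * cmod (g x0)"
      by (simp add: \<eta>_def algebra_simps)
    then have "1 - \<tau> \<le> cmod (g x0)" using d(1) by simp
    then obtain c where c: "norm c = 1" "norm (x0 - sX c x) < \<epsilon>"
      using slice[OF g(1,2) x g(3) x0(1)] by blast
    have nx0: "norm x0 = 1"
    proof -
      have "x0 \<noteq> 0"
        using N1 by (auto simp: N_def tilted_norm_def)
      then have "tilted_norm T h ((1 / norm x0) *\<^sub>R x0) \<le> N"
        unfolding N_def by (intro x0(2)) simp
      then have "N * 1 \<le> N * norm x0"
        using \<open>x0 \<noteq> 0\<close> by (simp add: tilted_norm_scaleR N_def divide_le_eq)
      then have "1 \<le> norm x0" using N1 by simp
      with x0(1) show ?thesis by simp
    qed
    have "norm g \<le> 1"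
      using g(2) by (intro norm_blinfun_bound) auto
    then have "d * norm g \<le> d * 1" using d(1) by (intro mult_left_mono) auto
    moreover have "norm h \<le> norm (h - d *\<^sub>R g) + d * norm g"
      using norm_triangle_ineq[of "h - d *\<^sub>R g" "d *\<^sub>R g"] d(1) by simp
    ultimately have nh: "norm h \<le> d + \<eta>"
      using h(2) by linarith
    have hx0: "cmod (h x0) \<le> d + \<eta>"
      using norm_blinfun[of h x0] nx0 nh by simp
    have N_le: "N \<le> 1 + d + \<eta>"
      using Tx0 hx0 by (simp add: N_def tilted_norm_def)
    have "0 < norm (blinfun_apply T x0)"
      using N1 hx0 \<eta> d unfolding N_def tilted_norm_def by linarith
    then have "blinfun_apply T x0 \<noteq> 0" by auto
    then obtain R where R: "R \<in> finite_rank_operators sX sY" "\<And>z. norm (blinfun_apply R z) = cmod (h z)"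
      "norm (blinfun_apply (T + R) x0) = N" "norm (T + R) = N"
      using rank_one_perturbation_attains_norm[OF hf nx0 x0(2)] unfolding N_def by metis
    define S0 where "S0 = T + R"
    define S where "S = (1 / N) *\<^sub>R S0"
    have S0M: "S0 \<in> M"
      unfolding S0_def using TM R(1) M(2) by (intro O.subspace_add[OF Msub]) auto
    then have SM: "S \<in> M"
      unfolding S_def by (rule M_scaleR)
    have S0_le: "norm (blinfun_apply S0 z) \<le> tilted_norm T h z" for z
      using norm_triangle_ineq[of "blinfun_apply T z" "blinfun_apply R z"]
      by (simp add: S0_def tilted_norm_def blinfun.add_left R(2))
    have S0x0: "norm (blinfun_apply S0 x0) = N" and nS0: "norm S0 = N"
      using R(3,4) by (simp_all add: S0_def)
    have nS: "norm S = 1" using N1 by (simp add: S_def nS0)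
    have "S - S0 = (1 / N - 1) *\<^sub>R S0"
      by (simp add: S_def scaleR_left_diff_distrib)
    then have "norm (S - S0) = \<bar>1 / N - 1\<bar> * N" by (simp add: nS0)
    also have "\<dots> = N - 1" using N1 by (simp add: abs_if field_simps)
    finally have "norm (S - S0) = N - 1" .
    moreover have "norm R \<le> norm h"
      by (intro norm_blinfun_bound) (auto simp: R(2) norm_blinfun)
    moreover have "norm (S - T) \<le> norm (S - S0) + norm R"
      using norm_triangle_ineq[of "S - S0" R] by (simp add: S0_def)
    ultimately have close: "norm (S - T) < \<epsilon>"
      using N_le nh \<eta> d \<epsilon> by linarith
    have "S \<in> ASE sX sY"
    proof (rule ASE_I[OF _ nx0])
      fix \<delta> :: real
      assume "0 < \<delta>"
      then obtain \<theta> where \<theta>: "0 < \<theta>" "\<And>z. z \<in> near_max (tilted_norm T h) \<theta> \<Longrightarrow>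
          \<exists>c. norm c = 1 \<and> norm (z - sX c x0) < \<delta>"
        using exposed by blast
      have "z \<in> near_max (tilted_norm T h) \<theta>"
        if z: "norm z \<le> 1" "norm S - \<theta> / N < norm (blinfun_apply S z)" for z
      proof -
        have "(N - \<theta>) / N < norm (blinfun_apply S0 z) / N"
          using z(2) N1 by (simp add: nS0 S_def blinfun.scaleR_left diff_divide_distrib)
        then have "N - \<theta> < norm (blinfun_apply S0 z)"
          using N1 by (simp add: divide_less_cancel)
        with S0_le[of z] have "N \<le> tilted_norm T h z + \<theta>" by simp
        then show ?thesis
          using z(1) x0(2) by (force simp: near_max_def N_def)
      qed
      with \<theta> N1 show "\<exists>\<theta>>0. \<forall>z. norm z \<le> 1 \<longrightarrow> norm S - \<theta> < norm (blinfun_apply S z) \<longrightarrow>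
          (\<exists>c. norm c = 1 \<and> norm (z - sX c x0) < \<delta>)"
        by (intro exI[of _ "\<theta> / N"]) auto
    qed (use SM MB in blast)
    (* x0 is close to the rotation c x of x, so it has to be rotated back. *)
    moreover define x1 where "x1 = sX (1 / c) x0"
    have "c \<noteq> 0" using c(1) by auto
    have "norm x1 = 1"
      by (simp add: x1_def X.norm_scale norm_divide c(1) nx0)
    moreover have "blinfun_apply S x1 = sY (1 / c) (blinfun_apply S x0)"
      using SM MB by (auto simp: x1_def bounded_operators_def Vector_Spaces.linear_iff)
    then have "norm (blinfun_apply S x1) = 1"
      using N1 by (simp add: Y.norm_scale norm_divide c(1) S_def blinfun.scaleR_left S0x0)
    moreover have "norm (x - x1) < \<epsilon>"
    proof -
      have "x0 - sX c x = sX c (x1 - x)"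
        using \<open>c \<noteq> 0\<close> by (simp add: x1_def X.scale_right_diff_distrib)
      with c show ?thesis by (simp add: X.norm_scale norm_minus_commute)
    qed
    ultimately show ?thesis
      using SM nS close by blast
  qed
  have "\<eta> < \<epsilon>" using \<eta> d \<epsilon> by linarith
  with \<eta>(1) main show "\<exists>\<eta>>0. \<eta> < \<epsilon> \<and>
      (\<forall>T\<in>M. \<forall>x. norm T = 1 \<longrightarrow> norm x = 1 \<longrightarrow> norm (blinfun_apply T x) > 1 - \<eta> \<longrightarrow>
        (\<exists>S\<in>ASE sX sY \<inter> M. \<exists>x0. norm x0 = 1 \<and> norm S = 1 \<and> norm (blinfun_apply S x0) = 1 \<and>
          norm (S - T) < \<epsilon> \<and> norm (x - x0) < \<epsilon>))"
    by blast
qed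

lemma subspace_bounded_operators:
  "linear_subspace_of_operators sX sY (bounded_operators sX sY)"
proof -
  interpret O: banach_over "scale_op sY :: 'k \<Rightarrow> ('x \<Rightarrow>\<^sub>L 'y) \<Rightarrow> _"
    by (rule Y.banach_over_scale_op)
  show ?thesis
    unfolding linear_subspace_of_operators_def
    by (intro conjI O.subspaceI)
      (auto simp: bounded_operators_def Vector_Spaces.linear_iff blinfun.add_left Y.scale_op_apply
        Y.scale_right_distrib mult.commute X.vector_space_axioms Y.vector_space_axioms)
qed

end

theorem theorem2p9:
  fixes sX :: "'k::real_or_complex \<Rightarrow> 'x::banach \<Rightarrow> 'x"
    and sY :: "'k \<Rightarrow> 'y::banach \<Rightarrow> 'y"
  assumes "banach_over sX" and "banach_over sY"
    and "uniformly_convex TYPE('x)"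
  shows "pair_has_BPBp_ASE sX sY \<and>
    (\<forall>M. linear_subspace_of_operators sX sY M \<and> finite_rank_operators sX sY \<subseteq> M \<longrightarrow>
       has_BPBp_ASE sX sY M)"
proof -
  obtain \<phi> :: "'k \<Rightarrow> complex" where "scalar_embedding \<phi>"
    using scalar_embedding_exists by blast
  with assms(1,2) interpret operator_setting sX sY \<phi>
    by (simp add: operator_setting_def)
  have "finite_rank_operators sX sY \<subseteq> bounded_operators sX sY"
    by (auto simp: finite_rank_operators_def)
  then have "pair_has_BPBp_ASE sX sY"
    unfolding pair_has_BPBp_ASE_def
    by (intro subspace_has_BPBp_ASE assms(3) subspace_bounded_operators)
  with subspace_has_BPBp_ASE[OF assms(3)] show ?thesis by blast
qed

end
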